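(* Let $L\colon[0,1]\to[0,1]$ be a Lipschitz function and $\varphi\colon\mathbb{N}\to(0,1]$ be a positive function. Then for any $\beta>1$, the set $$\mathfrak{R}_\beta(L,\varphi)=\{x\in[0,1]\colon |T_\beta^n x-L(x)|<\varphi(n)\text{ for infinitely many }n\in\mathbb{N}\}$$ satisfies $\mathcal{L}(\mathfrak{R}_\beta(L,\varphi))=0$ if $\sum_{n\ge1}\varphi(n)<+\infty$, and $\mathcal{L}(\mathfrak{R}_\beta(L,\varphi))=1$ if $\sum_{n\ge1}\varphi(n)=+\infty$.
   Context: $\mathbb{N}=\{1,2,\dots\}$ and $\mathcal{L}$ is Lebesgue measure. For $\beta>1$, the beta-transformation $T_\beta\colon[0,1]\to[0,1]$ is $T_\beta(x)=\beta x-\lfloor\beta x\rfloor$ for all $x\in[0,1]$; $T_\beta^n$ is its $n$-th iterate. *)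

theory Defs
  imports "HOL-Analysis.Analysis"
begin

text \<open>The formula is used on all of the reals; only its restriction to the unit interval,
  which it maps into itself, is relevant.\<close>

definition beta_map :: "real \<Rightarrow> real \<Rightarrow> real" where
  "beta_map \<beta> x = \<beta> * x - of_int \<lfloor>\<beta> * x\<rfloor>"

text \<open>The index set of the paper is the set of positive integers, hence the guard \<open>1 \<le> n\<close>.\<close>

definition recurrence_set :: "real \<Rightarrow> (real \<Rightarrow> real) \<Rightarrow> (nat \<Rightarrow> real) \<Rightarrow> real set" where
  "recurrence_set \<beta> L \<phi> =
     {x \<in> {0..1}. infinite {n. 1 \<le> n \<and> \<bar>(beta_map \<beta> ^^ n) x - L x\<bar> < \<phi> n}}"

end

theory Submission
  imports Defs
begin

text \<open>
  Write \<open>T\<close> for the beta-transformation, \<open>A n\<close> for the set of \<open>x\<close> with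
  \<open>\<bar>T\<^sup>n x - L x\<bar> < \<phi> n\<close> and \<open>\<mu>\<close> for Lebesgue measure. The set in question is, up to a null
  set, the limit superior of the \<open>A n\<close>, and the proof is a Borel-Cantelli argument in both
  directions.

  A cylinder of order \<open>n\<close> is a maximal interval on which \<open>T\<^sup>n\<close> is affine with slope \<open>\<beta>\<^sup>n\<close>. Since
  \<open>T\<^sup>n\<close> increases from \<open>0\<close> on each of them, cylinders correspond to their left endpoints, which are
  the zeros of \<open>T\<^sup>n\<close> in \<open>[0,1)\<close>; this replaces digit expansions and admissible words. Once \<open>\<beta>\<^sup>n\<close>
  dominates the Lipschitz constant of \<open>L\<close>, the map \<open>T\<^sup>n - L\<close> expands each cylinder by about \<open>\<beta>\<^sup>n\<close>,
  so \<open>A n\<close> meets a cylinder in a set of diameter at most \<open>4 \<phi> n / \<beta>\<^sup>n\<close>. If the cylinder is full,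
  that is, mapped onto \<open>[0,1)\<close>, then \<open>T\<^sup>n - L\<close> changes sign on it and \<open>A n\<close> does fill a portion of
  length \<open>\<phi> n / (2 \<beta>\<^sup>n)\<close>. Everything therefore reduces to counting cylinders in an interval of
  length \<open>l\<close>, and two counts suffice.

  Upper bound (\<open>zeros_card_le\<close>): just to the left of a zero that is new at order \<open>n\<close> there is a full
  cylinder of length \<open>\<beta>\<^sup>-\<^sup>n\<close>, so new zeros are \<open>\<beta>\<^sup>-\<^sup>n\<close>-separated and an interval contains at most
  \<open>\<beta>\<^sup>n l + 1\<close> of them. Summing over the orders bounds the number of all zeros of order \<open>n\<close> by
  \<open>K \<beta>\<^sup>n l + n\<close>, where \<open>K = \<beta> / (\<beta> - 1)\<close>. Lower bound (\<open>full_card_ge\<close>): the zeros of order \<open>n\<close> are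
  \<open>\<beta>\<^sup>-\<^sup>n\<close>-dense, and by the upper bound those older than the last \<open>p\<close> orders are a minority for a
  suitable constant \<open>p\<close>; hence one of the last \<open>p\<close> orders contributes a positive proportion of
  \<open>\<beta>\<^sup>n l\<close> new zeros, each with its full cylinder.

  The upper count with \<open>l = 1\<close> gives \<open>\<mu> (A n) \<le> const * \<phi> n\<close>, so a convergent series yields a null
  set. Applied twice, it gives for \<open>m \<le> n\<close> in an interval \<open>I\<close> of length \<open>l\<close> the quasi-independence
  \<open>\<mu> (A m \<inter> A n \<inter> I) \<le> const * l * \<phi> n * (\<phi> m + (n - m + 1) / \<beta>\<^sup>(\<^sup>n\<^sup>-\<^sup>m\<^sup>))\<close>. The last term sums over
  \<open>m\<close> to a constant, hence it is negligible when \<open>\<Sum> \<phi> n\<close> diverges, and the Chung-Erdos inequality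
  together with the lower count shows that every tail union of the \<open>A n\<close> fills a proportion of \<open>I\<close>
  that depends on \<open>\<beta>\<close> only. A set whose complement occupies a fixed proportion of every interval
  is null, so almost every point belongs to every tail union.
\<close>

section \<open>Counting and covering on the line\<close>

lemma separated_card_le:
  fixes S :: "real set"
  assumes S: "S \<subseteq> {u..v}" and sep: "\<And>x y. x \<in> S \<Longrightarrow> y \<in> S \<Longrightarrow> x < y \<Longrightarrow> x + \<delta> \<le> y"
    and \<delta>: "0 < \<delta>" and uv: "u \<le> v"
  shows "finite S" "real (card S) \<le> (v - u) / \<delta> + 1"
proof -
  let ?f = "\<lambda>x. nat \<lfloor>(x - u) / \<delta>\<rfloor>"
  have inj: "inj_on ?f S"
  proof (rule linorder_inj_onI)
    fix x y assume xy: "x < y" "x \<in> S" "y \<in> S"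
    have "(x - u + \<delta>) / \<delta> \<le> (y - u) / \<delta>"
      using sep[OF xy(2,3,1)] \<delta> by (intro divide_right_mono) auto
    then have "(x - u) / \<delta> + 1 \<le> (y - u) / \<delta>"
      using \<delta> by (simp add: add_divide_distrib)
    moreover have "0 \<le> (x - u) / \<delta>" using xy(2) S \<delta> by auto
    ultimately show "?f x \<noteq> ?f y" by linarith
  qed auto
  have sub: "?f ` S \<subseteq> {..nat \<lfloor>(v - u) / \<delta>\<rfloor>}"
    using S \<delta> by (auto intro!: nat_mono floor_mono divide_right_mono)
  show "finite S"
    using finite_imageD[OF finite_subset[OF sub] inj] by simp
  have "card S \<le> nat \<lfloor>(v - u) / \<delta>\<rfloor> + 1"
    using card_mono[OF _ sub] card_image[OF inj] by simp
  moreover have "0 \<le> (v - u) / \<delta>" using uv \<delta> by simp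
  ultimately show "real (card S) \<le> (v - u) / \<delta> + 1" by linarith
qed

text \<open>Covering numbers compose under nested decompositions, unlike measure bounds on pieces whose
  measurability would have to be established first. The bound \<open>k\<close> is real because it arises as a
  product of counting estimates.\<close>

definition covered_by :: "real set \<Rightarrow> real \<Rightarrow> real \<Rightarrow> bool" where
  "covered_by X k d \<longleftrightarrow> (\<exists>S. finite S \<and> real (card S) \<le> k \<and> X \<subseteq> (\<Union>c\<in>S. {c..c + d}))"

lemma covered_by_UN:
  assumes "finite P" "\<And>p. p \<in> P \<Longrightarrow> covered_by (X p) k d"
  shows "covered_by (\<Union>p\<in>P. X p) (real (card P) * k) d"
proof -
  from assms(2) obtain S where S: "\<And>p. p \<in> P \<Longrightarrow>
      finite (S p) \<and> real (card (S p)) \<le> k \<and> X p \<subseteq> (\<Union>c\<in>S p. {c..c + d})"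
    unfolding covered_by_def by metis
  have "real (card (\<Union>p\<in>P. S p)) \<le> (\<Sum>p\<in>P. real (card (S p)))"
    using card_UN_le[OF assms(1), of S] by (metis of_nat_le_iff of_nat_sum)
  also have "\<dots> \<le> real (card P) * k" using S by (intro sum_bounded_above) auto
  finally show ?thesis
    unfolding covered_by_def using assms(1) S by (intro exI[of _ "\<Union>p\<in>P. S p"]) fastforce
qed

lemma covered_by_mono: "covered_by X k d \<Longrightarrow> Y \<subseteq> X \<Longrightarrow> k \<le> l \<Longrightarrow> covered_by Y l d"
  unfolding covered_by_def by (meson order_trans)

lemma measure_covered_by_le:
  assumes "covered_by X k d" "X \<in> sets lebesgue" "0 \<le> d"
  shows "measure lebesgue X \<le> k * d"
proof -
  obtain S where S: "finite S" "real (card S) \<le> k" "X \<subseteq> (\<Union>c\<in>S. {c..c + d})"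
    using assms(1) unfolding covered_by_def by auto
  have "measure lebesgue X \<le> measure lebesgue (\<Union>c\<in>S. {c..c + d})"
    using S assms(2) by (intro measure_mono_fmeasurable fmeasurable.finite_UN) auto
  also have "\<dots> \<le> (\<Sum>c\<in>S. measure lebesgue {c..c + d})"
    using S by (intro measure_UNION_le) auto
  also have "\<dots> = real (card S) * d" using assms(3) by simp
  also have "\<dots> \<le> k * d" using S assms(3) by (intro mult_right_mono) auto
  finally show ?thesis .
qed

lemma subset_interval_of_diameter:
  fixes X :: "real set"
  assumes "bdd_below X" "\<And>x y. x \<in> X \<Longrightarrow> y \<in> X \<Longrightarrow> y - x \<le> d"
  obtains c where "X \<subseteq> {c..c + d}"
proof (cases "X = {}")
  case False
  have "y \<in> {Inf X..Inf X + d}" if "y \<in> X" for y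
  proof -
    have "y - d \<le> Inf X" using False assms(2)[OF _ that] by (intro cInf_greatest) force+
    then show ?thesis using cInf_lower[OF that assms(1)] by simp
  qed
  then show thesis using that by blast
qed (use that in auto)

section \<open>A second-moment bound and a density criterion\<close>

text \<open>With \<open>f\<close> the number of sets \<open>E i\<close> that contain a point and \<open>U\<close> their union,
  \<open>f = f * indicator U\<close>, so this is the Cauchy-Schwarz inequality for \<open>f\<close> and the indicator of \<open>U\<close>.
  It is the lower bound for unions that needs independence only on average.\<close>

lemma Chung_Erdos:
  assumes fin: "finite I" and E: "\<And>i. i \<in> I \<Longrightarrow> E i \<in> fmeasurable M"
  shows "(\<Sum>i\<in>I. measure M (E i))\<^sup>2
    \<le> measure M (\<Union>i\<in>I. E i) * (\<Sum>i\<in>I. \<Sum>j\<in>I. measure M (E i \<inter> E j))"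
proof -
  define U where "U = (\<Union>i\<in>I. E i)"
  define f :: "_ \<Rightarrow> real" where "f x = (\<Sum>i\<in>I. indicator (E i) x)" for x
  define a where "a = (\<Sum>i\<in>I. measure M (E i))"
  define b where "b = (\<Sum>i\<in>I. \<Sum>j\<in>I. measure M (E i \<inter> E j))"
  have U: "U \<in> fmeasurable M" unfolding U_def using fin E by (rule fmeasurable.finite_UN)
  have EE: "E i \<inter> E j \<in> fmeasurable M" if "i \<in> I" "j \<in> I" for i j
    using that E by (intro fmeasurable.Int) auto
  have ind: "integrable M (indicator A :: _ \<Rightarrow> real)" "integral\<^sup>L M (indicator A) = measure M A"
    if "A \<in> fmeasurable M" for A
    using that fmeasurableD[OF that] fmeasurableD2[OF that]
    by (auto simp: integrable_indicator_iff less_top fmeasurable_def Int_absorb2 sets.sets_into_space)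
  have f: "integrable M f" "integral\<^sup>L M f = a"
    unfolding f_def[abs_def] a_def using E ind by (simp_all add: Bochner_Integration.integral_sum)
  have f2_eq: "(f x)\<^sup>2 = (\<Sum>i\<in>I. \<Sum>j\<in>I. indicator (E i \<inter> E j) x)" for x
    by (simp add: f_def power2_eq_square sum_product indicator_inter_arith)
  have f2: "integrable M (\<lambda>x. (f x)\<^sup>2)" "integral\<^sup>L M (\<lambda>x. (f x)\<^sup>2) = b"
    unfolding f2_eq b_def using EE ind by (simp_all add: Bochner_Integration.integral_sum)
  \<comment> \<open>The quadratic in \<open>t\<close> whose discriminant is the claim: integrate the square of
    \<open>indicator U - t * f\<close>.\<close>
  have quad: "0 \<le> measure M U - 2 * t * a + t\<^sup>2 * b" for t
  proof -
    have "0 \<le> (\<integral>x. indicator U x - 2 * t * f x + t\<^sup>2 * (f x)\<^sup>2 \<partial>M)"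
    proof (rule integral_nonneg_AE, rule AE_I2)
      fix x
      show "0 \<le> indicator U x - 2 * t * f x + t\<^sup>2 * (f x)\<^sup>2"
      proof (cases "x \<in> U")
        case True
        then have "indicator U x - 2 * t * f x + t\<^sup>2 * (f x)\<^sup>2 = (1 - t * f x)\<^sup>2"
          by (simp add: power2_eq_square algebra_simps)
        then show ?thesis by simp
      next
        case False
        then have "f x = 0" by (auto simp: f_def U_def intro!: sum.neutral)
        then show ?thesis using False by simp
      qed
    qed
    also have "\<dots> = measure M U - 2 * t * a + t\<^sup>2 * b"
      using f f2 ind[OF U] by simp
    finally show ?thesis .
  qed
  \<comment> \<open>The diagonal terms are part of \<open>b\<close>; this excludes \<open>b = 0 < a\<close>.\<close>
  have diag: "a \<le> b"
  proof -
    have "measure M (E i) \<le> (\<Sum>j\<in>I. measure M (E i \<inter> E j))" if "i \<in> I" for i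
      using member_le_sum[of i I "\<lambda>j. measure M (E i \<inter> E j)"] that fin by simp
    then show ?thesis unfolding a_def b_def by (intro sum_mono)
  qed
  have "0 \<le> a" unfolding a_def by (simp add: sum_nonneg)
  have "a\<^sup>2 \<le> measure M U * b"
  proof (cases "b = 0")
    case True
    then show ?thesis using diag \<open>0 \<le> a\<close> by simp
  next
    case False
    then have "0 < b" using diag \<open>0 \<le> a\<close> by linarith
    then have "0 \<le> b * (measure M U - 2 * (a / b) * a + (a / b)\<^sup>2 * b)"
      using quad[of "a / b"] by (intro mult_nonneg_nonneg) auto
    also have "\<dots> = measure M U * b - a\<^sup>2"
      using \<open>0 < b\<close> by (simp add: field_simps power2_eq_square)
    finally show ?thesis by simp
  qed
  then show ?thesis by (simp add: U_def a_def b_def)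
qed

text \<open>An elementary substitute for the Lebesgue density theorem: cover \<open>B\<close> by non-overlapping
  intervals of total length little more than \<open>\<mu> B\<close>. In each of them \<open>B\<close> has relative measure at
  most \<open>1 - c\<close>, so \<open>\<mu> B\<close> is at most \<open>1 - c\<close> times a number close to \<open>\<mu> B\<close>.\<close>

lemma negligible_if_density_bounded:
  fixes B :: "real set"
  assumes B: "B \<in> sets lebesgue" "B \<subseteq> {0..1}" and "0 < c"
    and le: "\<And>u v. 0 \<le> u \<Longrightarrow> u < v \<Longrightarrow> v \<le> 1 \<Longrightarrow> measure lebesgue ({u..v} \<inter> B) \<le> (1 - c) * (v - u)"
  shows "negligible B"
proof -
  have Bm: "B \<in> lmeasurable"
    by (rule fmeasurableI2[of "{0..1}"]) (use B in auto)
  have B01: "B \<subseteq> cbox 0 1" using B(2) by (simp add: cbox_interval)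
  define \<mu> where "\<mu> = measure lebesgue B"
  have c1: "c \<le> 1" using order_trans[OF measure_nonneg le[of 0 1]] by simp
  have "\<mu> \<le> 0"
  proof (rule ccontr)
    assume "\<not> \<mu> \<le> 0"
    then have "0 < c * \<mu>" using \<open>0 < c\<close> by simp
    \<comment> \<open>The excess \<open>c * \<mu>\<close> is small enough, as \<open>(1 - c) * (1 + c) < 1\<close>.\<close>
    obtain \<D> where \<D>: "countable \<D>"
      "\<And>J. J \<in> \<D> \<Longrightarrow> J \<subseteq> cbox 0 1 \<and> J \<noteq> {} \<and> (\<exists>c d. J = cbox c (d::real))"
      "pairwise (\<lambda>A B. interior A \<inter> interior B = {}) \<D>"
      "\<And>u v. cbox u v \<in> \<D> \<Longrightarrow> \<exists>n. \<forall>i\<in>Basis. v \<bullet> i - u \<bullet> i = (1 \<bullet> i - 0 \<bullet> i) / 2 ^ n"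
      "\<And>J. J \<in> \<D> \<Longrightarrow> box 0 (1::real) \<noteq> {} \<Longrightarrow> interior J \<noteq> {}"
      "B \<subseteq> \<Union>\<D>" "\<Union>\<D> \<in> lmeasurable" "measure lebesgue (\<Union>\<D>) \<le> measure lebesgue B + c * \<mu>"
      using measurable_outer_intervals_bounded[OF Bm B01 \<open>0 < c * \<mu>\<close>] by metis
    note \<D>_cover = \<D>(6,7) and \<D>_measure = \<D>(8)[folded \<mu>_def]
    have int_le: "emeasure lebesgue (B \<inter> interior J) \<le> ennreal (1 - c) * emeasure lebesgue (interior J)"
      if J: "J \<in> \<D>" for J
    proof -
      obtain p q where pq: "J = {p..q}" using \<D>(2)[OF J] unfolding cbox_interval by blast
      have "interior J \<noteq> {}" using \<D>(5)[OF J] by (simp add: box_real)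
      then have "p < q" by (simp add: pq)
      have "{p..q} \<subseteq> {0..1}" using \<D>(2)[OF J] unfolding pq cbox_interval by blast
      then have sub: "0 \<le> p" "q \<le> 1" using \<open>p < q\<close> by simp_all
      have "measure lebesgue (B \<inter> {p<..<q}) \<le> measure lebesgue ({p..q} \<inter> B)"
      proof (rule measure_mono_fmeasurable)
        show "B \<inter> {p<..<q} \<subseteq> {p..q} \<inter> B" by auto
        show "B \<inter> {p<..<q} \<in> sets lebesgue" using B(1) by auto
        show "{p..q} \<inter> B \<in> lmeasurable" using B(1) by (intro fmeasurable_Int_fmeasurable) simp_all
      qed
      also have "\<dots> \<le> (1 - c) * (q - p)" by (rule le[OF sub(1) \<open>p < q\<close> sub(2)])
      finally have "measure lebesgue (B \<inter> {p<..<q}) \<le> (1 - c) * (q - p)" .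
      moreover have "B \<inter> {p<..<q} \<in> lmeasurable" using Bm by (intro fmeasurable.Int) simp_all
      ultimately have "emeasure lebesgue (B \<inter> {p<..<q}) \<le> ennreal ((1 - c) * (q - p))"
        by (simp add: emeasure_eq_measure2 ennreal_leI)
      then show ?thesis
        using c1 \<open>p < q\<close> by (simp add: pq ennreal_mult)
    qed
    \<comment> \<open>Only the interiors are disjoint; the endpoints form a countable union of null sets.\<close>
    let ?V = "\<Union>J\<in>\<D>. interior J"
    have int_sets: "interior J \<in> sets lebesgue" "B \<inter> interior J \<in> sets lebesgue" for J
      using B(1) borel_open[OF open_interior, of J] by auto
    have disj: "disjoint_family_on (\<lambda>J. B \<inter> interior J) \<D>" "disjoint_family_on interior \<D>"
      using \<D>(3) unfolding disjoint_family_on_def pairwise_def by blast+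
    have "emeasure lebesgue ?V \<le> emeasure lebesgue (\<Union>\<D>)"
    proof (rule emeasure_mono)
      show "?V \<subseteq> \<Union>\<D>" using interior_subset by blast
      show "\<Union>\<D> \<in> sets lebesgue" using \<D>_cover(2) by (rule fmeasurableD)
    qed
    also have "\<dots> \<le> ennreal (\<mu> + c * \<mu>)"
      using \<D>_measure by (simp add: emeasure_eq_measure2[OF \<D>_cover(2)] ennreal_leI)
    finally have V: "emeasure lebesgue ?V \<le> ennreal (\<mu> + c * \<mu>)" .
    have "emeasure lebesgue (B \<inter> ?V) = emeasure lebesgue (\<Union>J\<in>\<D>. B \<inter> interior J)"
      by (simp only: Int_UN_distrib)
    also have "\<dots> = (\<integral>\<^sup>+J. emeasure lebesgue (B \<inter> interior J) \<partial>count_space \<D>)"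
      using int_sets(2) \<D>(1) disj(1) by (rule emeasure_UN_countable)
    also have "\<dots> \<le> (\<integral>\<^sup>+J. ennreal (1 - c) * emeasure lebesgue (interior J) \<partial>count_space \<D>)"
      by (rule nn_integral_mono) (use int_le in simp)
    also have "\<dots> = ennreal (1 - c) * (\<integral>\<^sup>+J. emeasure lebesgue (interior J) \<partial>count_space \<D>)"
      by (rule nn_integral_cmult) simp
    also have "\<dots> = ennreal (1 - c) * emeasure lebesgue ?V"
      by (subst emeasure_UN_countable[OF int_sets(1) \<D>(1) disj(2)]) simp
    also have "\<dots> \<le> ennreal (1 - c) * ennreal (\<mu> + c * \<mu>)"
      using V by (rule mult_left_mono) simp
    also have "\<dots> = ennreal ((1 - c) * (\<mu> + c * \<mu>))"
      using c1 \<open>0 < c * \<mu>\<close> \<open>\<not> \<mu> \<le> 0\<close> by (simp add: ennreal_mult)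
    finally have BV: "emeasure lebesgue (B \<inter> ?V) \<le> ennreal ((1 - c) * (\<mu> + c * \<mu>))" .
    have "negligible (\<Union>J\<in>\<D>. J - interior J)"
    proof (rule negligible_countable_Union)
      show "countable ((\<lambda>J. J - interior J) ` \<D>)" using \<D>(1) by simp
      fix S assume "S \<in> (\<lambda>J. J - interior J) ` \<D>"
      then obtain J where J: "J \<in> \<D>" "S = J - interior J" by blast
      moreover obtain p q where "J = cbox p q" using \<D>(2)[OF J(1)] by blast
      ultimately have "S = cbox p q - box p q" by (simp only: interior_cbox)
      then show "negligible S" by (simp only: negligible_frontier_interval)
    qed
    then have "negligible (B - ?V)" by (rule negligible_subset) (use \<D>_cover(1) in blast)
    then have null: "B - ?V \<in> null_sets lebesgue" by (simp add: negligible_iff_null_sets)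
    have BV_sets: "B \<inter> ?V \<in> sets lebesgue"
      using B(1) by (intro sets.Int) (simp_all add: open_Union)
    have "emeasure lebesgue B = emeasure lebesgue ((B \<inter> ?V) \<union> (B - ?V))"
      by (rule arg_cong[of _ _ "emeasure lebesgue"]) blast
    also have "\<dots> = emeasure lebesgue (B \<inter> ?V)"
      by (rule emeasure_Un_null_set[OF BV_sets null])
    also note BV
    finally have "\<mu> \<le> (1 - c) * (\<mu> + c * \<mu>)"
      using Bm c1 \<open>0 < c * \<mu>\<close> \<open>\<not> \<mu> \<le> 0\<close> by (simp add: emeasure_eq_measure2 \<mu>_def[symmetric])
    also have "\<dots> = \<mu> - c * (c * \<mu>)" by (simp add: algebra_simps)
    finally show False using mult_pos_pos[OF \<open>0 < c\<close> \<open>0 < c * \<mu>\<close>] by linarith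
  qed
  then show ?thesis
    using measure_nonneg[of lebesgue B] Bm by (simp add: negligible_iff_measure0 \<mu>_def)
qed

section \<open>Cylinders of the beta-transformation\<close>

locale beta_transformation =
  fixes \<beta> :: real
  assumes \<beta>_gt_1: "1 < \<beta>"
begin

abbreviation T :: "real \<Rightarrow> real" where "T \<equiv> beta_map \<beta>"

text \<open>The left endpoint of the cylinder of order \<open>n\<close> that contains \<open>x\<close>: going left from \<open>x\<close> with
  slope \<open>\<beta>\<^sup>n\<close>, the graph of the current branch of \<open>T\<^sup>n\<close> reaches \<open>0\<close> there. Two points lie in the same
  cylinder iff they have the same base.\<close>

definition base :: "nat \<Rightarrow> real \<Rightarrow> real" where
  "base n x = x - (T ^^ n) x / \<beta> ^ n"

definition zeros :: "nat \<Rightarrow> real set" where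
  "zeros n = {z \<in> {0..<1}. (T ^^ n) z = 0}"

text \<open>Left endpoints of full cylinders, that is, those which \<open>T\<^sup>n\<close> maps onto \<open>[0,1)\<close>.\<close>

definition full :: "nat \<Rightarrow> real set" where
  "full n = {a. 0 \<le> a \<and> a + 1 / \<beta> ^ n \<le> 1 \<and> (\<forall>s\<in>{0..<1 / \<beta> ^ n}. (T ^^ n) (a + s) = \<beta> ^ n * s)}"

lemma \<beta>_pos: "0 < \<beta>" and \<beta>_nonzero [simp]: "\<beta> \<noteq> 0" and pow_pos: "0 < \<beta> ^ n"
  using \<beta>_gt_1 by auto

lemma T_eq_frac: "T x = frac (\<beta> * x)"
  by (simp add: beta_map_def frac_def)

lemma iter_Suc: "(T ^^ Suc n) x = (T ^^ n) (T x)"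
  by (simp add: funpow_swap1)

lemma T_range: "T x \<in> {0..<1}"
  by (simp add: T_eq_frac frac_lt_1)

lemma iter_range: "x \<in> {0..<1} \<Longrightarrow> (T ^^ n) x \<in> {0..<1}"
  using T_range by (cases n) auto

lemma iter_small: "0 \<le> y \<Longrightarrow> y < 1 / \<beta> ^ n \<Longrightarrow> (T ^^ n) y = \<beta> ^ n * y"
proof (induction n arbitrary: y)
  case (Suc n)
  have "\<beta> * y < 1 / \<beta> ^ n"
    using Suc.prems \<beta>_pos by (simp add: field_simps)
  moreover have "1 / \<beta> ^ n \<le> 1" using \<beta>_gt_1 by simp
  ultimately have "\<beta> * y < 1" by linarith
  then have "T y = \<beta> * y"
    using Suc.prems(1) \<beta>_pos by (simp add: T_eq_frac frac_eq)
  then show ?case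
    using Suc.IH[of "\<beta> * y"] Suc.prems(1) \<beta>_pos \<open>\<beta> * y < 1 / \<beta> ^ n\<close>
    unfolding iter_Suc by (simp add: mult_ac)
qed simp

text \<open>The inverse branch through \<open>x\<close> carries the base of \<open>T x\<close> to the base of \<open>x\<close>.\<close>

lemma base_Suc: "base (Suc n) x = (of_int \<lfloor>\<beta> * x\<rfloor> + base n (T x)) / \<beta>"
  unfolding base_def iter_Suc using \<beta>_pos
  by (simp add: beta_map_def field_simps)

lemma base_nonneg: "x \<in> {0..<1} \<Longrightarrow> 0 \<le> base n x"
proof (induction n arbitrary: x)
  case (Suc n)
  show ?case
    unfolding base_Suc using Suc.IH[OF T_range] Suc.prems \<beta>_pos by simp
qed (simp add: base_def)

lemma base_le: "x \<in> {0..<1} \<Longrightarrow> base n x \<le> x"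
  using iter_range[of x n] pow_pos[of n] by (simp add: base_def)

lemma base_gt: "x \<in> {0..<1} \<Longrightarrow> x - 1 / \<beta> ^ n < base n x"
  using iter_range[of x n] pow_pos[of n] by (simp add: base_def divide_strict_right_mono)

text \<open>Nothing is cut between the base of \<open>x\<close> and \<open>x\<close>: if \<open>y\<close> lies there, then \<open>\<beta> * y\<close> is at least
  \<open>\<lfloor>\<beta> * x\<rfloor>\<close> because the base of \<open>T x\<close> is nonnegative, so \<open>x\<close> and \<open>y\<close> have the same first digit and
  the induction continues with \<open>T x\<close> and \<open>T y\<close>.\<close>

lemma iter_affine:
  "x \<in> {0..<1} \<Longrightarrow> base n x \<le> y \<Longrightarrow> y \<le> x \<Longrightarrow> (T ^^ n) y = (T ^^ n) x - \<beta> ^ n * (x - y)"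
proof (induction n arbitrary: x y)
  case (Suc n)
  have low: "of_int \<lfloor>\<beta> * x\<rfloor> + base n (T x) \<le> \<beta> * y"
    using Suc.prems(2) \<beta>_pos unfolding base_Suc by (simp add: field_simps)
  have up: "\<beta> * y \<le> \<beta> * x" using Suc.prems(3) \<beta>_pos by simp
  have "0 \<le> base n (T x)" by (rule base_nonneg[OF T_range])
  then have fl: "\<lfloor>\<beta> * y\<rfloor> = \<lfloor>\<beta> * x\<rfloor>" using low up by linarith
  have "(T ^^ n) (T y) = (T ^^ n) (T x) - \<beta> ^ n * (T x - T y)"
    by (rule Suc.IH[OF T_range]) (use fl low up in \<open>simp_all add: beta_map_def\<close>)
  also have "T x - T y = \<beta> * (x - y)"
    using fl by (simp add: beta_map_def algebra_simps)
  finally show ?case unfolding iter_Suc by simp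
qed simp

lemma base_in_zeros: "x \<in> {0..<1} \<Longrightarrow> base n x \<in> zeros n"
  using iter_affine[of x n "base n x"] base_nonneg[of x n] base_le[of x n] pow_pos[of n]
  by (auto simp: zeros_def base_def)

lemma zeros_0: "zeros 0 = {0}"
  by (auto simp: zeros_def)

text \<open>Together with \<open>base_in_zeros\<close>: the base of \<open>x\<close> is the largest zero of \<open>T\<^sup>n\<close> that does not
  exceed \<open>x\<close>, since \<open>T\<^sup>n\<close> is positive between the base and \<open>x\<close>.\<close>

lemma zero_le_base:
  assumes z: "z \<in> zeros n" and x: "x \<in> {0..<1}" and "z \<le> x"
  shows "z \<le> base n x"
proof (rule ccontr)
  assume "\<not> z \<le> base n x"
  then have "base n x < z" by simp
  then have "(T ^^ n) z = (T ^^ n) x - \<beta> ^ n * (x - z)"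
    using iter_affine[OF x _ \<open>z \<le> x\<close>] by simp
  also have "\<dots> = \<beta> ^ n * (z - base n x)"
    using pow_pos[of n] by (simp add: base_def field_simps)
  also have "\<dots> > 0" using \<open>base n x < z\<close> pow_pos[of n] by simp
  finally show False using z by (simp add: zeros_def)
qed

lemma full_gap:
  assumes "a \<in> full n" "z \<in> zeros n" "a < z"
  shows "a + 1 / \<beta> ^ n \<le> z"
proof (rule ccontr)
  assume "\<not> ?thesis"
  then have "z - a \<in> {0..<1 / \<beta> ^ n}" using assms by auto
  then have "(T ^^ n) (a + (z - a)) = \<beta> ^ n * (z - a)"
    using assms(1) unfolding full_def by blast
  then have "\<beta> ^ n * (z - a) = 0"
    using assms(2) by (simp add: zeros_def)
  then show False using assms(3) pow_pos[of n] by simp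
qed

lemma full_subset_zeros: "full n \<subseteq> zeros n"
proof
  fix a assume a: "a \<in> full n"
  have pos: "0 < 1 / \<beta> ^ n" using pow_pos by simp
  then have "(T ^^ n) (a + 0) = \<beta> ^ n * 0"
    using a unfolding full_def mem_Collect_eq by (meson atLeastLessThan_iff order_refl)
  moreover have "a < 1" "0 \<le> a" using a pos unfolding full_def mem_Collect_eq by linarith+
  ultimately show "a \<in> zeros n" by (simp add: zeros_def)
qed

text \<open>The leftmost part of a full cylinder is full again, because \<open>T\<^sup>k\<close> is multiplication by
  \<open>\<beta>\<^sup>k\<close> near \<open>0\<close>.\<close>

lemma full_mono:
  assumes "m \<le> n"
  shows "full m \<subseteq> full n"
proof
  fix a assume a: "a \<in> full m"
  obtain k where n: "n = k + m" using assms by (metis le_add_diff_inverse2)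
  have le: "1 / \<beta> ^ n \<le> 1 / \<beta> ^ m"
    using \<beta>_gt_1 assms by (intro divide_left_mono power_increasing) auto
  show "a \<in> full n"
    unfolding full_def
  proof (intro CollectI conjI ballI)
    show "0 \<le> a" "a + 1 / \<beta> ^ n \<le> 1" using a le unfolding full_def by auto
    fix s assume s: "s \<in> {0..<1 / \<beta> ^ n}"
    then have "(T ^^ m) (a + s) = \<beta> ^ m * s" using a le unfolding full_def by auto
    moreover have "\<beta> ^ m * s < 1 / \<beta> ^ k"
      using s \<beta>_pos by (simp add: n field_simps power_add)
    ultimately show "(T ^^ n) (a + s) = \<beta> ^ n * s"
      using iter_small[of "\<beta> ^ m * s" k] s \<beta>_pos by (simp add: n funpow_add power_add)
  qed
qed

text \<open>A zero that is new at order \<open>n + 1\<close> is not the left endpoint of its cylinder of order \<open>n\<close>.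
  There \<open>\<beta> * T\<^sup>n z\<close> is a positive integer, and the last unit that \<open>\<beta> * T\<^sup>n\<close> climbs before \<open>z\<close>
  is a complete branch of \<open>T\<^sup>n\<^sup>+\<^sup>1\<close>.\<close>

lemma full_before_new_zero:
  assumes z: "z \<in> zeros (Suc n)" and new: "z \<notin> zeros n"
  shows "z - 1 / \<beta> ^ Suc n \<in> full (Suc n)"
proof -
  let ?t = "(T ^^ n) z" and ?a = "z - 1 / \<beta> ^ Suc n"
  have z01: "z \<in> {0..<1}" using z by (simp add: zeros_def)
  have t_pos: "0 < ?t" using new z01 iter_range[OF z01, of n] by (auto simp: zeros_def)
  have "frac (\<beta> * ?t) = 0" using z by (simp add: zeros_def T_eq_frac)
  then have int: "\<beta> * ?t \<in> \<int>" by simp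
  moreover have "0 < \<beta> * ?t" using t_pos \<beta>_pos by simp
  ultimately have one: "1 \<le> \<beta> * ?t" by (auto elim!: Ints_cases)
  have "base n z \<le> ?a"
    using one \<beta>_pos pow_pos[of n] by (simp add: base_def field_simps)
  moreover have "0 \<le> base n z" by (rule base_nonneg[OF z01])
  moreover have "(T ^^ Suc n) (?a + s) = \<beta> ^ Suc n * s" if s: "s \<in> {0..<1 / \<beta> ^ Suc n}" for s
  proof -
    have "(T ^^ n) (?a + s) = ?t - \<beta> ^ n * (z - (?a + s))"
      by (rule iter_affine[OF z01]) (use \<open>base n z \<le> ?a\<close> s in auto)
    also have "\<dots> = ?t - 1 / \<beta> + \<beta> ^ n * s"
      by (simp add: field_simps)
    finally have "\<beta> * (T ^^ n) (?a + s) = \<beta> * (?t - 1 / \<beta> + \<beta> ^ n * s)"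
      by (rule arg_cong)
    also have "\<dots> = (\<beta> * ?t - 1) + \<beta> ^ Suc n * s"
      by (simp add: field_simps)
    finally have "\<beta> * (T ^^ n) (?a + s) = (\<beta> * ?t - 1) + \<beta> ^ Suc n * s" .
    moreover have "\<beta> * ?t - 1 \<in> \<int>" using int by simp
    moreover have "0 \<le> \<beta> ^ Suc n * s" "\<beta> ^ Suc n * s < 1"
      using s pow_pos[of "Suc n"] less_imp_le[OF pow_pos, of "Suc n"]
      by (auto simp: field_simps intro!: mult_nonneg_nonneg simp del: power_Suc)
    ultimately show ?thesis
      by (simp add: T_eq_frac frac_unique_iff)
  qed
  ultimately show ?thesis using z01 by (auto simp: full_def)
qed

text \<open>The full cylinder that ends at a new zero contains no other zero in its interior, so the new
  zeros are separated by \<open>1 / \<beta>\<^sup>n\<^sup>+\<^sup>1\<close>.\<close>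

lemma new_zeros_card_le:
  assumes "u \<le> v"
  shows "finite ((zeros (Suc n) - zeros n) \<inter> {u<..v})"
    and "real (card ((zeros (Suc n) - zeros n) \<inter> {u<..v})) \<le> \<beta> ^ Suc n * (v - u) + 1"
proof -
  let ?S = "(zeros (Suc n) - zeros n) \<inter> {u<..v}"
  have sep: "x + 1 / \<beta> ^ Suc n \<le> y" if xy: "x \<in> ?S" "y \<in> ?S" "x < y" for x y
  proof (rule ccontr)
    assume "\<not> ?thesis"
    then have "y - 1 / \<beta> ^ Suc n < x" by simp
    moreover have "y - 1 / \<beta> ^ Suc n \<in> full (Suc n)"
      using full_before_new_zero xy by auto
    ultimately show False using full_gap[of _ "Suc n" x] xy by force
  qed
  have sub: "?S \<subseteq> {u..v}" and pos: "0 < 1 / \<beta> ^ Suc n" using pow_pos[of "Suc n"] by auto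
  show "finite ?S"
    using separated_card_le(1)[OF sub sep pos assms] .
  show "real (card ?S) \<le> \<beta> ^ Suc n * (v - u) + 1"
    using separated_card_le(2)[OF sub sep pos assms] by (simp add: mult.commute)
qed

section \<open>Counting cylinders\<close>

text \<open>The sum of the geometric series with ratio \<open>1 / \<beta>\<close>.\<close>

definition K :: real where "K = \<beta> / (\<beta> - 1)"

lemma K_gt_1: "1 < K"
  using \<beta>_gt_1 by (simp add: K_def)

text \<open>The error term \<open>n - m\<close>, rather than \<open>n\<close>, is what makes the overlap of two hitting sets decay
  in \<open>n - m\<close>; it is the reason for counting only zeros younger than order \<open>m\<close>.\<close>

lemma zeros_card_le:
  assumes "m \<le> n" "u \<le> v"
  shows "finite ((zeros n - zeros m) \<inter> {u<..v})
    \<and> real (card ((zeros n - zeros m) \<inter> {u<..v})) \<le> real (n - m) + K * \<beta> ^ n * (v - u)"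
  using assms(1)
proof (induction n rule: dec_induct)
  case base
  then show ?case using assms(2) K_gt_1 pow_pos[of m] by simp
next
  case (step n)
  let ?Z = "\<lambda>n m. (zeros n - zeros m) \<inter> {u<..v}"
  have sub: "?Z (Suc n) m \<subseteq> ?Z n m \<union> ?Z (Suc n) n" by auto
  note new = new_zeros_card_le[OF assms(2), of n]
  have "card (?Z (Suc n) m) \<le> card (?Z n m) + card (?Z (Suc n) n)"
    using card_mono[OF _ sub] card_Un_le[of "?Z n m" "?Z (Suc n) n"] step.IH new(1) by auto
  then have "real (card (?Z (Suc n) m)) \<le> real (card (?Z n m)) + real (card (?Z (Suc n) n))"
    by linarith
  also have "\<dots> \<le> (real (n - m) + K * \<beta> ^ n * (v - u)) + (\<beta> ^ Suc n * (v - u) + 1)"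
    using step.IH new(2) by simp
  also have "\<dots> = real (Suc n - m) + (K * \<beta> ^ n + \<beta> ^ Suc n) * (v - u)"
    using step.hyps by (simp add: algebra_simps Suc_diff_le)
  also have "K * \<beta> ^ n + \<beta> ^ Suc n = K * \<beta> ^ Suc n"
    using \<beta>_gt_1 by (simp add: K_def field_simps)
  finally show ?case using finite_subset[OF sub] step.IH new(1) by auto
qed

text \<open>The number of cylinders of order \<open>n\<close> that meet a set \<open>X\<close> of diameter at most \<open>d\<close> which lies
  inside one cylinder of order \<open>m\<close>. The leftmost of them contributes \<open>1\<close>. Every other one has its
  base strictly to the right of some point of \<open>X\<close>, hence inside that cylinder of order \<open>m\<close>, hence
  its base is a zero younger than order \<open>m\<close>. For \<open>m = 0\<close> the assumption on \<open>base m\<close> is trivial.\<close>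

lemma base_image_card_le:
  assumes X: "X \<subseteq> {0..<1}" and cd: "X \<subseteq> {c..c + d}" and "0 \<le> d"
    and "m \<le> n" and const: "\<And>x y. x \<in> X \<Longrightarrow> y \<in> X \<Longrightarrow> base m x = base m y"
  shows "finite (base n ` X)" "real (card (base n ` X)) \<le> 1 + real (n - m) + K * \<beta> ^ n * d"
proof -
  define Z where "Z = (zeros n - zeros m) \<inter> {c<..c + d}"
  \<comment> \<open>\<open>R\<close> will turn out to contain at most the leftmost base.\<close>
  define R where "R = base n ` X - Z"
  have left: "base n y \<le> x" if y: "y \<in> X" "base n y \<notin> Z" and x: "x \<in> X" for x y
  proof (cases "base n y \<in> zeros m")
    case True
    have y01: "y \<in> {0..<1}" and x01: "x \<in> {0..<1}" using x y X by blast+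
    have "base n y \<le> base m y"
      by (rule zero_le_base[OF True y01 base_le[OF y01]])
    also have "\<dots> = base m x" by (rule const[OF y(1) x])
    also have "\<dots> \<le> x" by (rule base_le[OF x01])
    finally show ?thesis .
  next
    case False
    have "y \<in> {0..<1}" using y X by blast
    then have "base n y \<in> zeros n" "base n y \<le> y" by (rule base_in_zeros, rule base_le)
    moreover have "y \<le> c + d" "c \<le> x" using x y cd by auto
    ultimately show ?thesis using y(2) False unfolding Z_def by force
  qed
  have le: "base n y \<le> base n x" if "y \<in> X" "base n y \<notin> Z" "x \<in> X" for x y
  proof (rule zero_le_base[OF _ _ left[OF that]])
    show "base n y \<in> zeros n" by (rule base_in_zeros) (use that X in blast)
    show "x \<in> {0..<1}" using that X by blast
  qed
  obtain p where p: "R \<subseteq> {p}"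
  proof (cases "R = {}")
    case False
    then obtain x where x: "x \<in> X" "base n x \<notin> Z" unfolding R_def by blast
    have "q = base n x" if q: "q \<in> R" for q
    proof -
      obtain y where "y \<in> X" "base n y \<notin> Z" "q = base n y" using q unfolding R_def by blast
      then show ?thesis using le[of y x] le[of x y] x by simp
    qed
    then have "R \<subseteq> {base n x}" by blast
    then show ?thesis by (rule that)
  qed (use that in blast)
  have R: "finite R" "card R \<le> 1"
    using finite_subset[OF p] card_mono[OF _ p] by simp_all
  have Z: "finite Z" "real (card Z) \<le> real (n - m) + K * \<beta> ^ n * d"
    using zeros_card_le[OF \<open>m \<le> n\<close>, of c "c + d"] \<open>0 \<le> d\<close> unfolding Z_def by simp_all
  have sub: "base n ` X \<subseteq> R \<union> Z" unfolding R_def by blast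
  show "finite (base n ` X)" using finite_subset[OF sub] R Z by simp
  have "card (base n ` X) \<le> card R + card Z"
    using card_mono[OF _ sub] card_Un_le[of R Z] R Z by simp
  then show "real (card (base n ` X)) \<le> 1 + real (n - m) + K * \<beta> ^ n * d"
    using R Z by linarith
qed

text \<open>Every point lies within \<open>1 / \<beta>\<^sup>n\<close> of its base, so each interval of a subdivision into pieces
  of this length contains a zero.\<close>

lemma zeros_card_ge:
  assumes "0 \<le> u" "u \<le> v" "v \<le> 1"
  shows "\<beta> ^ n * (v - u) - 1 \<le> real (card (zeros n \<inter> {u<..v}))"
proof -
  define k where "k = nat (\<lceil>\<beta> ^ n * (v - u)\<rceil> - 1)"
  \<comment> \<open>The largest \<open>k\<close> for which all \<open>x i\<close> with \<open>i < k\<close> are strictly below \<open>v\<close>, hence below \<open>1\<close>.\<close>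
  define x where "x i = u + real (Suc i) / \<beta> ^ n" for i
  have x: "x i \<in> {0..<1}" "x i < v" "base n (x i) \<in> zeros n \<inter> {u + real i / \<beta> ^ n<..x i}"
    if "i < k" for i
  proof -
    have "real (Suc i) < \<beta> ^ n * (v - u)" using that unfolding k_def by linarith
    then show *: "x i < v" using pow_pos[of n] unfolding x_def by (simp add: field_simps)
    have "0 \<le> x i" using assms(1) pow_pos[of n] by (simp add: x_def)
    with * show "x i \<in> {0..<1}" using assms by auto
    then show "base n (x i) \<in> zeros n \<inter> {u + real i / \<beta> ^ n<..x i}"
      using base_in_zeros base_le base_gt[of "x i" n] by (auto simp: x_def add_divide_distrib)
  qed
  have "inj_on (\<lambda>i. base n (x i)) {..<k}"
  proof (rule linorder_inj_onI)
    fix i j assume ij: "i < j" "i \<in> {..<k}" "j \<in> {..<k}"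
    have "base n (x i) \<le> x i" using x(3)[of i] ij by auto
    also have "x i \<le> u + real j / \<beta> ^ n"
      using ij pow_pos[of n] unfolding x_def by (intro add_left_mono divide_right_mono) auto
    also have "\<dots> < base n (x j)" using x(3)[of j] ij by auto
    finally show "base n (x i) \<noteq> base n (x j)" by simp
  qed auto
  then have "k = card ((\<lambda>i. base n (x i)) ` {..<k})" by (simp add: card_image)
  also have "\<dots> \<le> card (zeros n \<inter> {u<..v})"
  proof (rule card_mono)
    have "zeros n \<inter> {u<..v} \<subseteq> insert 0 ((zeros n - zeros 0) \<inter> {u<..v})" by (auto simp: zeros_0)
    then show "finite (zeros n \<inter> {u<..v})"
      using zeros_card_le[of 0 n u v] assms by (meson finite.insertI finite_subset le0)
    show "(\<lambda>i. base n (x i)) ` {..<k} \<subseteq> zeros n \<inter> {u<..v}"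
    proof
      fix z assume "z \<in> (\<lambda>i. base n (x i)) ` {..<k}"
      then obtain i where i: "i < k" "z = base n (x i)" by auto
      have "0 \<le> real i / \<beta> ^ n" using pow_pos[of n] by simp
      then show "z \<in> zeros n \<inter> {u<..v}" using x[OF i(1)] i(2) by auto
    qed
  qed
  finally show ?thesis unfolding k_def by linarith
qed

text \<open>The square of the geometric series, as a Cauchy product.\<close>

lemma pow_inverse_sum:
  shows "summable (\<lambda>j. real (Suc j) / \<beta> ^ j)" "(\<Sum>j. real (Suc j) / \<beta> ^ j) = K\<^sup>2"
proof -
  have "norm (1 / \<beta>) < 1" using \<beta>_gt_1 by simp
  from geometric_deriv_sums[OF this]
  have "(\<lambda>j. real (Suc j) / \<beta> ^ j) sums (1 / (1 - 1 / \<beta>)\<^sup>2)"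
    by (simp add: divide_inverse power_inverse)
  moreover have "1 / (1 - 1 / \<beta>)\<^sup>2 = K\<^sup>2"
    using \<beta>_gt_1 by (simp add: K_def field_simps power2_eq_square)
  ultimately show "summable (\<lambda>j. real (Suc j) / \<beta> ^ j)" "(\<Sum>j. real (Suc j) / \<beta> ^ j) = K\<^sup>2"
    by (simp_all add: sums_iff)
qed

lemma eventually_linear_le:
  assumes "0 \<le> c" "0 < \<epsilon>"
  shows "\<forall>\<^sub>F n in sequentially. c + real n \<le> \<epsilon> * \<beta> ^ n"
proof -
  have "(\<lambda>n. real (Suc n) / \<beta> ^ n) \<longlonglongrightarrow> 0"
    by (rule summable_LIMSEQ_zero[OF pow_inverse_sum(1)])
  then have "\<forall>\<^sub>F n in sequentially. real (Suc n) / \<beta> ^ n < \<epsilon> / (c + 1)"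
    by (rule order_tendstoD) (use assms in simp)
  then show ?thesis
  proof eventually_elim
    case (elim n)
    then have "(c + 1) * real (Suc n) < \<epsilon> * \<beta> ^ n"
      using pow_pos[of n] assms by (simp add: field_simps)
    moreover have "c + real n \<le> (c + 1) * real (Suc n)"
      using assms by (simp add: algebra_simps)
    ultimately show ?case by linarith
  qed
qed

lemma zeros_subset_new:
  assumes "m \<le> n"
  shows "zeros n \<subseteq> zeros m \<union> (\<Union>j\<in>{m..<n}. zeros (Suc j) - zeros j)"
  using assms
proof (induction n rule: dec_induct)
  case (step n)
  have "zeros (Suc n) \<subseteq> zeros n \<union> (zeros (Suc n) - zeros n)" by blast
  moreover have "{m..<Suc n} = insert n {m..<n}" using step.hyps by auto
  ultimately show ?case using step.IH by auto
qed simp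

text \<open>In every interval the full cylinders of order \<open>n\<close> number at least a fixed proportion of
  \<open>\<beta>\<^sup>n (v - u)\<close>, with a constant \<open>\<kappa>\<close> that is independent of the interval. By density there are
  about \<open>\<beta>\<^sup>n (v - u)\<close> zeros of order \<open>n\<close>. At most about a quarter of this number are zeros of order
  \<open>n - p\<close>, so by the pigeonhole principle one of the \<open>p\<close> steps from there to order \<open>n\<close> creates at
  least a \<open>1 / (2 * p)\<close> fraction. To the left of each of these lies a full cylinder, whose
  leftmost part is full of order \<open>n\<close>.\<close>

lemma full_card_ge:
  obtains \<kappa> where "0 < \<kappa>"
    "\<And>u v. 0 \<le> u \<Longrightarrow> u < v \<Longrightarrow> v \<le> 1 \<Longrightarrow> \<forall>\<^sub>F n in sequentially.
       \<exists>G. finite G \<and> G \<subseteq> full n \<and> (\<forall>a\<in>G. u \<le> a \<and> a + 1 / \<beta> ^ n \<le> v) \<and>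
           \<kappa> * \<beta> ^ n * (v - u) \<le> real (card G)"
proof -
  \<comment> \<open>Chosen so that \<open>K * \<beta> ^ (n - p)\<close>, the density of the zeros of order \<open>n - p\<close>, is at most
    \<open>\<beta> ^ n / 4\<close>.\<close>
  obtain p where p: "4 * K < \<beta> ^ p" using real_arch_pow[OF \<beta>_gt_1] by blast
  have "0 < p" using p K_gt_1 by (cases p) auto
  define \<kappa> where "\<kappa> = 1 / (2 * real p)"
  have \<kappa>: "0 < \<kappa>" "real p * \<kappa> = 1 / 2" using \<open>0 < p\<close> by (simp_all add: \<kappa>_def)
  show thesis
  proof (rule that[OF \<kappa>(1)])
    fix u v :: real assume uv: "0 \<le> u" "u < v" "v \<le> 1"
    have "\<forall>\<^sub>F n in sequentially. (\<beta> ^ p + 1) + real n \<le> ((v - u) / 4) * \<beta> ^ n"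
      using uv pow_pos[of p] by (intro eventually_linear_le) auto
    moreover have "\<forall>\<^sub>F n in sequentially. p \<le> n" by (rule eventually_ge_at_top)
    ultimately show "\<forall>\<^sub>F n in sequentially.
       \<exists>G. finite G \<and> G \<subseteq> full n \<and> (\<forall>a\<in>G. u \<le> a \<and> a + 1 / \<beta> ^ n \<le> v) \<and>
           \<kappa> * \<beta> ^ n * (v - u) \<le> real (card G)"
    proof eventually_elim
      case (elim n)
      define m where "m = n - p"
      \<comment> \<open>The margin keeps the cylinders to the left of the chosen zeros inside \<open>{u..v}\<close>.\<close>
      define w where "w = u + 1 / \<beta> ^ m"
      define b where "b = \<beta> ^ n * (v - u)"
      have mn: "n = m + p" using elim(2) by (simp add: m_def)
      have big: "\<beta> ^ p + 1 + real n \<le> b / 4" using elim(1) by (simp add: b_def mult_ac)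
      have w_eq: "\<beta> ^ n * (v - w) = b - \<beta> ^ p"
        using pow_pos[of m] by (simp add: w_def b_def mn power_add field_simps)
      have "0 < b" using uv pow_pos[of n] by (simp add: b_def)
      then have "0 \<le> \<beta> ^ n * (v - w)" using w_eq big by linarith
      then have wv: "w \<le> v" using pow_pos[of n] by (simp add: zero_le_mult_iff)
      have w_pos: "0 < w" "u \<le> w" using uv pow_pos[of m] by (simp_all add: w_def add_nonneg_pos)
      define D where "D j = (zeros (Suc j) - zeros j) \<inter> {w<..v}" for j
      have fin_D: "finite (D j)" for j using new_zeros_card_le[OF wv] by (simp add: D_def)
      have old: "finite ((zeros m - zeros 0) \<inter> {w<..v})"
        "real (card ((zeros m - zeros 0) \<inter> {w<..v})) \<le> real m + K * \<beta> ^ m * (v - w)"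
        using zeros_card_le[OF _ wv, of 0 m] by simp_all
      have "b - \<beta> ^ p - 1 \<le> real (card (zeros n \<inter> {w<..v}))"
        using zeros_card_ge[of w v n] w_pos wv uv w_eq by simp
      also have "zeros n \<inter> {w<..v} \<subseteq> ((zeros m - zeros 0) \<inter> {w<..v}) \<union> (\<Union>j\<in>{m..<n}. D j)"
        using zeros_subset_new[of m n] w_pos by (auto simp: D_def zeros_0 mn)
      then have "card (zeros n \<inter> {w<..v})
          \<le> card ((zeros m - zeros 0) \<inter> {w<..v} \<union> (\<Union>j\<in>{m..<n}. D j))"
        using old(1) fin_D by (intro card_mono) auto
      also have "\<dots> \<le> card ((zeros m - zeros 0) \<inter> {w<..v}) + (\<Sum>j\<in>{m..<n}. card (D j))"
        by (rule order_trans[OF card_Un_le add_left_mono[OF card_UN_le]]) simp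
      finally have "b - \<beta> ^ p - 1
          \<le> (real m + K * \<beta> ^ m * (v - w)) + (\<Sum>j\<in>{m..<n}. real (card (D j)))"
        using old(2) by simp
      moreover have "K * \<beta> ^ m * (v - w) \<le> b / 4"
      proof -
        have "K * \<beta> ^ m * (v - w) \<le> (\<beta> ^ p / 4) * \<beta> ^ m * (v - u)"
          using p w_pos wv K_gt_1 \<beta>_pos by (intro mult_mono) auto
        then show ?thesis by (simp add: b_def mn power_add mult_ac)
      qed
      ultimately have "b / 2 \<le> (\<Sum>j\<in>{m..<n}. real (card (D j)))"
        using big mn by simp
      moreover have "(\<Sum>j\<in>{m..<n}. \<kappa> * b) = b / 2"
        using \<kappa>(2) by (simp add: mn)
      ultimately obtain j where j: "j \<in> {m..<n}" "\<kappa> * b \<le> real (card (D j))"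
        using sum_strict_mono[of "{m..<n}" "\<lambda>j. real (card (D j))" "\<lambda>_. \<kappa> * b"] \<open>0 < p\<close> mn
        by (metis (no_types, lifting) add_le_same_cancel1 atLeastLessThan_empty_iff finite_atLeastLessThan leD leI)
      define G where "G = (\<lambda>z. z - 1 / \<beta> ^ Suc j) ` D j"
      have le1: "1 / \<beta> ^ Suc j \<le> 1 / \<beta> ^ m" and le2: "1 / \<beta> ^ n \<le> 1 / \<beta> ^ Suc j"
        using j(1) \<beta>_gt_1 by (auto intro!: divide_left_mono power_increasing simp del: power_Suc)
      have "G \<subseteq> full (Suc j)" using full_before_new_zero by (auto simp: G_def D_def)
      also have "\<dots> \<subseteq> full n" using full_mono j(1) by simp
      finally have "G \<subseteq> full n" .
      moreover have "\<forall>a\<in>G. u \<le> a \<and> a + 1 / \<beta> ^ n \<le> v"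
      proof
        fix a assume "a \<in> G"
        then obtain z where z: "z \<in> {w<..v}" "a = z - 1 / \<beta> ^ Suc j" by (auto simp: G_def D_def)
        then show "u \<le> a \<and> a + 1 / \<beta> ^ n \<le> v" using le1 le2 by (simp add: w_def)
      qed
      moreover have "card G = card (D j)"
        unfolding G_def by (rule card_image) (auto simp: inj_on_def)
      ultimately show ?case
        using j(2) fin_D by (intro exI[of _ G]) (simp add: G_def b_def mult_ac)
    qed
  qed
qed

end

section \<open>Size of the hitting sets\<close>

locale beta_recurrence = beta_transformation +
  fixes L :: "real \<Rightarrow> real" and C :: real and \<phi> :: "nat \<Rightarrow> real"
  assumes L_range: "x \<in> {0..1} \<Longrightarrow> L x \<in> {0..1}"
    and L_lipschitz: "C-lipschitz_on {0..1} L"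
    and \<phi>_pos: "1 \<le> n \<Longrightarrow> 0 < \<phi> n"
    and \<phi>_le_1: "1 \<le> n \<Longrightarrow> \<phi> n \<le> 1"
begin

definition hits :: "nat \<Rightarrow> real set" where
  "hits n = {x \<in> {0..<1}. \<bar>(T ^^ n) x - L x\<bar> < \<phi> n}"

lemma hits_subset: "hits n \<subseteq> {0..<1}"
  by (auto simp: hits_def)

lemma L_diff_le: "x \<in> {0..1} \<Longrightarrow> y \<in> {0..1} \<Longrightarrow> \<bar>L x - L y\<bar> \<le> C * \<bar>x - y\<bar>"
  using lipschitz_onD[OF L_lipschitz] by (simp add: dist_real_def)

lemma C_nonneg: "0 \<le> C"
  using lipschitz_on_nonneg[OF L_lipschitz] .

lemma iter_measurable: "(T ^^ n) \<in> borel_measurable borel"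
proof (induction n)
  case (Suc n)
  have T: "T \<in> borel_measurable borel" unfolding beta_map_def[abs_def] by measurable
  show ?case using measurable_comp[OF Suc.IH T] by (simp add: comp_def)
qed simp

lemma hits_sets: "hits n \<in> sets lebesgue"
proof -
  define h where "h x = indicator {0..1} x *\<^sub>R L x" for x :: real
  have [measurable]: "h \<in> borel_measurable borel"
    unfolding h_def[abs_def] using lipschitz_on_continuous_on[OF L_lipschitz]
    by (rule borel_measurable_continuous_on_indicator[rotated]) simp
  note [measurable] = iter_measurable[of n]
  have "hits n = {0..<1} \<inter> {x. \<bar>(T ^^ n) x - h x\<bar> < \<phi> n}"
    by (auto simp: hits_def h_def)
  moreover have "{x. \<bar>(T ^^ n) x - h x\<bar> < \<phi> n} \<in> sets borel" by measurable
  ultimately have "hits n \<in> sets borel" by simp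
  then show ?thesis by simp
qed

lemma hits_Int_lmeasurable: "A \<in> sets lebesgue \<Longrightarrow> hits n \<inter> A \<in> lmeasurable"
  by (rule fmeasurableI2[of "{0..1}"]) (use hits_sets in \<open>auto simp: hits_def\<close>)

lemma large_mono:
  assumes "2 * C \<le> \<beta> ^ m" "m \<le> n"
  shows "2 * C \<le> \<beta> ^ n"
  using assms(1) power_increasing[OF assms(2), of \<beta>] \<beta>_gt_1 by linarith

text \<open>On a cylinder of order \<open>n\<close> the slope of \<open>T\<^sup>n - L\<close> is at least \<open>\<beta>\<^sup>n - C\<close>, which is at least
  \<open>\<beta>\<^sup>n / 2\<close>, whereas its values at points of \<open>hits n\<close> differ by less than \<open>2 * \<phi> n\<close>.\<close>

lemma hits_cylinder_diameter:
  assumes xy: "x \<in> hits n" "y \<in> hits n" "base n x = base n y"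
    and n: "1 \<le> n" "2 * C \<le> \<beta> ^ n"
  shows "y - x \<le> 4 * \<phi> n / \<beta> ^ n"
proof (cases "x \<le> y")
  case True
  have x01: "x \<in> {0..<1}" and y01: "y \<in> {0..<1}" using xy by (simp_all add: hits_def)
  have "(T ^^ n) x = (T ^^ n) y - \<beta> ^ n * (y - x)"
    using iter_affine[OF y01 _ True] base_le[OF x01, of n] xy(3) by simp
  moreover have "\<bar>L x - L y\<bar> \<le> C * (y - x)"
    using L_diff_le[of x y] x01 y01 True by simp
  ultimately have "\<beta> ^ n * (y - x) \<le> 2 * \<phi> n + C * (y - x)"
    using xy(1,2) unfolding hits_def by (simp add: abs_less_iff abs_le_iff)
  moreover have "2 * C * (y - x) \<le> \<beta> ^ n * (y - x)"
    using n(2) True by (intro mult_right_mono) auto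
  ultimately have "\<beta> ^ n * (y - x) \<le> 4 * \<phi> n" by linarith
  then show ?thesis using pow_pos[of n] by (simp add: field_simps)
next
  case False
  have "0 \<le> 4 * \<phi> n / \<beta> ^ n" using \<phi>_pos[OF n(1)] pow_pos[of n] by simp
  then show ?thesis using False by linarith
qed

lemma hits_cylinder_interval:
  assumes "X \<subseteq> hits n" "\<And>x y. x \<in> X \<Longrightarrow> y \<in> X \<Longrightarrow> base n x = base n y"
    and n: "1 \<le> n" "2 * C \<le> \<beta> ^ n"
  obtains c where "X \<subseteq> {c..c + 4 * \<phi> n / \<beta> ^ n}"
proof (rule subset_interval_of_diameter[where X = X and d = "4 * \<phi> n / \<beta> ^ n"])
  show "bdd_below X"
    by (rule bdd_belowI[of _ 0]) (use assms(1) hits_subset in force)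
  show "y - x \<le> 4 * \<phi> n / \<beta> ^ n" if "x \<in> X" "y \<in> X" for x y
    using hits_cylinder_diameter[OF _ _ _ n] assms(1,2) that by blast
qed (rule that)

lemma hits_covered:
  assumes X: "X \<subseteq> hits n" "X \<subseteq> {c..c + d}" "0 \<le> d"
    and const: "\<And>x y. x \<in> X \<Longrightarrow> y \<in> X \<Longrightarrow> base m x = base m y"
    and n: "1 \<le> n" "2 * C \<le> \<beta> ^ n" "m \<le> n"
  shows "covered_by X (1 + real (n - m) + K * \<beta> ^ n * d) (4 * \<phi> n / \<beta> ^ n)"
proof -
  have X01: "X \<subseteq> {0..<1}" using X(1) hits_subset by (rule subset_trans)
  note card = base_image_card_le[OF X01 X(2,3) n(3) const]
  have "covered_by {x \<in> X. base n x = p} 1 (4 * \<phi> n / \<beta> ^ n)" for p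
  proof -
    obtain e where "{x \<in> X. base n x = p} \<subseteq> {e..e + 4 * \<phi> n / \<beta> ^ n}"
      by (rule hits_cylinder_interval[where X = "{x \<in> X. base n x = p}" and n = n])
        (use X(1) n in auto)
    then show ?thesis unfolding covered_by_def by (intro exI[of _ "{e}"]) simp
  qed
  from covered_by_UN[OF card(1) this]
  show ?thesis by (rule covered_by_mono) (use card(2) in auto)
qed

text \<open>A two-scale covering: each cylinder of order \<open>m\<close> that meets the interval retains only a short
  interval of \<open>hits m\<close>, and this short interval is cut by the cylinders of order \<open>n\<close>.\<close>

lemma hits_pair_covered:
  assumes mn: "1 \<le> m" "m \<le> n" and m: "2 * C \<le> \<beta> ^ m" and uv: "u \<le> v"
  shows "covered_by (hits m \<inter> hits n \<inter> {u..v})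
    ((1 + real m + K * \<beta> ^ m * (v - u)) * (1 + real (n - m) + 4 * K * \<beta> ^ (n - m) * \<phi> m))
    (4 * \<phi> n / \<beta> ^ n)"
proof -
  let ?k = "1 + real (n - m) + 4 * K * \<beta> ^ (n - m) * \<phi> m"
  have Y: "hits m \<inter> {u..v} \<subseteq> {0..<1}" using hits_subset by blast
  have P: "finite (base m ` (hits m \<inter> {u..v}))"
    "real (card (base m ` (hits m \<inter> {u..v}))) \<le> 1 + real m + K * \<beta> ^ m * (v - u)"
    using base_image_card_le[OF Y, of u "v - u" 0 m] uv by (auto simp: base_def)
  have "covered_by {x \<in> hits m \<inter> hits n \<inter> {u..v}. base m x = p} ?k (4 * \<phi> n / \<beta> ^ n)" for p
  proof -
    let ?X = "{x \<in> hits m \<inter> hits n \<inter> {u..v}. base m x = p}"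
    obtain c where c: "?X \<subseteq> {c..c + 4 * \<phi> m / \<beta> ^ m}"
      by (rule hits_cylinder_interval[where X = ?X and n = m]) (use mn m in auto)
    have "covered_by ?X (1 + real (n - m) + K * \<beta> ^ n * (4 * \<phi> m / \<beta> ^ m)) (4 * \<phi> n / \<beta> ^ n)"
    proof (rule hits_covered[OF _ c])
      show "0 \<le> 4 * \<phi> m / \<beta> ^ m" using \<phi>_pos[OF mn(1)] pow_pos[of m] by simp
      show "1 \<le> n" "2 * C \<le> \<beta> ^ n" using mn large_mono[OF m mn(2)] by auto
    qed (use mn in auto)
    moreover have "\<beta> ^ n = \<beta> ^ (n - m) * \<beta> ^ m" using mn by (simp flip: power_add)
    ultimately show ?thesis by (simp add: mult_ac)
  qed
  from covered_by_UN[OF P(1) this]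
  show ?thesis
  proof (rule covered_by_mono)
    show "hits m \<inter> hits n \<inter> {u..v}
      \<subseteq> (\<Union>p\<in>base m ` (hits m \<inter> {u..v}). {x \<in> hits m \<inter> hits n \<inter> {u..v}. base m x = p})"
      by auto
    have "0 \<le> ?k"
      using \<phi>_pos[OF mn(1)] pow_pos[of "n - m"] K_gt_1 by (intro add_nonneg_nonneg) auto
    then show "real (card (base m ` (hits m \<inter> {u..v}))) * ?k
      \<le> (1 + real m + K * \<beta> ^ m * (v - u)) * ?k"
      using P(2) by (rule mult_right_mono[rotated])
  qed
qed

text \<open>A single term of the series with sum \<open>K\<^sup>2\<close>.\<close>

lemma linear_le_square_K: "1 + real n \<le> K\<^sup>2 * \<beta> ^ n"
proof -
  have "sum (\<lambda>j. real (Suc j) / \<beta> ^ j) {n} \<le> (\<Sum>j. real (Suc j) / \<beta> ^ j)"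
    using \<beta>_pos by (intro sum_le_suminf pow_inverse_sum(1)) auto
  then have "real (Suc n) / \<beta> ^ n \<le> K\<^sup>2" by (simp only: pow_inverse_sum(2)) simp
  then show ?thesis using pow_pos[of n] by (simp add: field_simps)
qed

lemma measure_hits_le:
  assumes n: "1 \<le> n" "2 * C \<le> \<beta> ^ n"
  shows "measure lebesgue (hits n) \<le> 4 * (K\<^sup>2 + K) * \<phi> n"
proof -
  have d: "0 \<le> 4 * \<phi> n / \<beta> ^ n" using \<phi>_pos[OF n(1)] pow_pos[of n] by simp
  have "covered_by (hits n) (1 + real (n - 0) + K * \<beta> ^ n * 1) (4 * \<phi> n / \<beta> ^ n)"
    by (rule hits_covered[where c = 0]) (use n hits_subset in \<open>force simp: base_def\<close>)+
  then have "measure lebesgue (hits n) \<le> (1 + real n + K * \<beta> ^ n) * (4 * \<phi> n / \<beta> ^ n)"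
    using measure_covered_by_le[OF _ hits_sets d] by simp
  also have "\<dots> \<le> ((K\<^sup>2 + K) * \<beta> ^ n) * (4 * \<phi> n / \<beta> ^ n)"
    using linear_le_square_K[of n] d by (intro mult_right_mono) (auto simp: algebra_simps)
  also have "\<dots> = 4 * (K\<^sup>2 + K) * \<phi> n" by (simp add: field_simps)
  finally show ?thesis .
qed

text \<open>The estimate of \<open>hits_pair_covered\<close> for orders so large that the linear error in the number
  of cylinders of order \<open>m\<close> is absorbed by the main term. The first summand is what independence
  would give up to a constant, the second one is summable in \<open>n - m\<close>.\<close>

lemma measure_hits_pair_le:
  assumes mn: "1 \<le> m" "m \<le> n" and m: "2 * C \<le> \<beta> ^ m" and uv: "u \<le> v"
    and big: "1 + real m \<le> K * (v - u) * \<beta> ^ m"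
  shows "measure lebesgue (hits m \<inter> hits n \<inter> {u..v})
    \<le> 8 * K * (v - u) * \<phi> n * (4 * K * \<phi> m + real (Suc (n - m)) / \<beta> ^ (n - m))"
proof -
  let ?k = "1 + real (n - m) + 4 * K * \<beta> ^ (n - m) * \<phi> m"
  have d: "0 \<le> 4 * \<phi> n / \<beta> ^ n" using \<phi>_pos[of n] mn pow_pos[of n] by simp
  have k: "0 \<le> ?k"
    using \<phi>_pos[OF mn(1)] pow_pos[of "n - m"] K_gt_1 by (intro add_nonneg_nonneg) auto
  have "measure lebesgue (hits m \<inter> hits n \<inter> {u..v})
      \<le> ((1 + real m + K * \<beta> ^ m * (v - u)) * ?k) * (4 * \<phi> n / \<beta> ^ n)"
    by (rule measure_covered_by_le[OF hits_pair_covered[OF mn m uv] _ d]) (use hits_sets in auto)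
  also have "\<dots> \<le> ((2 * (K * \<beta> ^ m * (v - u))) * ?k) * (4 * \<phi> n / \<beta> ^ n)"
    using big k d by (intro mult_right_mono) (auto simp: mult_ac)
  also have "\<beta> ^ n = \<beta> ^ m * \<beta> ^ (n - m)" using mn by (simp flip: power_add)
  also have "((2 * (K * \<beta> ^ m * (v - u))) * ?k) * (4 * \<phi> n / (\<beta> ^ m * \<beta> ^ (n - m)))
      = 8 * K * (v - u) * \<phi> n * (?k / \<beta> ^ (n - m))"
    using pow_pos[of m] by (simp add: field_simps)
  also have "?k / \<beta> ^ (n - m) = 4 * K * \<phi> m + real (Suc (n - m)) / \<beta> ^ (n - m)"
    using pow_pos[of "n - m"] by (simp add: field_simps)
  finally show ?thesis .
qed

text \<open>On a full cylinder \<open>T\<^sup>n\<close> runs from \<open>0\<close> to \<open>1\<close> while \<open>L\<close> stays in \<open>[0,1]\<close>, so they meet at some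
  \<open>z\<close> of the closed cylinder, and near \<open>z\<close> their difference has slope at most \<open>\<beta>\<^sup>n + C\<close>.\<close>

lemma measure_hits_full_ge:
  assumes a: "a \<in> full n" and n: "1 \<le> n" "2 * C \<le> \<beta> ^ n"
  shows "\<phi> n / (2 * \<beta> ^ n) \<le> measure lebesgue (hits n \<inter> {a..<a + 1 / \<beta> ^ n})"
proof -
  define e where "e = a + 1 / \<beta> ^ n"
  \<comment> \<open>The continuous extension of \<open>T\<^sup>n - L\<close> to the right endpoint, where \<open>T\<^sup>n\<close> itself drops to \<open>0\<close>.\<close>
  define g where "g x = \<beta> ^ n * (x - a) - L x" for x
  define \<rho> where "\<rho> = \<phi> n / (2 * \<beta> ^ n)"
  have \<rho>: "0 < \<rho>" "\<beta> ^ n * \<rho> = \<phi> n / 2"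
    using \<phi>_pos[OF n(1)] pow_pos[of n] by (simp_all add: \<rho>_def)
  have e: "0 \<le> a" "a < e" "e \<le> 1"
    using a pow_pos[of n] by (auto simp: full_def e_def)
  have short: "2 * \<rho> \<le> e - a"
    using \<phi>_le_1[OF n(1)] pow_pos[of n] by (simp add: e_def \<rho>_def divide_right_mono)
  have ea: "\<beta> ^ n * (e - a) = 1" by (simp add: e_def)
  obtain z where z: "a \<le> z" "z \<le> e" "g z = 0"
  proof -
    have "continuous_on {a..e} L"
      using lipschitz_on_continuous_on[OF L_lipschitz] by (rule continuous_on_subset) (use e in auto)
    then have "continuous_on {a..e} g" unfolding g_def by (intro continuous_intros)
    moreover have "g a \<le> 0" using L_range[of a] e by (simp add: g_def)
    moreover have "0 \<le> g e" using L_range[of e] e ea by (simp add: g_def)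
    ultimately show thesis using IVT'[of g a 0 e] e that by auto
  qed
  \<comment> \<open>Even if \<open>z\<close> is an endpoint, half of the window of radius \<open>\<rho>\<close> around it stays in the cylinder.\<close>
  have "{max a (z - \<rho>)<..<min e (z + \<rho>)} \<subseteq> hits n \<inter> {a..<e}"
  proof
    fix x assume x: "x \<in> {max a (z - \<rho>)<..<min e (z + \<rho>)}"
    then have "x - a \<in> {0..<1 / \<beta> ^ n}" by (simp add: e_def)
    then have Tx: "(T ^^ n) x = \<beta> ^ n * (x - a)" using a unfolding full_def by fastforce
    have "(T ^^ n) x - L x = g x - g z" using z(3) Tx by (simp add: g_def)
    also have "\<dots> = \<beta> ^ n * (x - z) - (L x - L z)" by (simp add: g_def algebra_simps)
    also have "\<bar>\<dots>\<bar> \<le> \<beta> ^ n * \<bar>x - z\<bar> + C * \<bar>x - z\<bar>"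
      using abs_triangle_ineq4[of "\<beta> ^ n * (x - z)" "L x - L z"] L_diff_le[of x z] x z e pow_pos[of n]
      by (simp add: abs_mult)
    also have "\<dots> \<le> \<beta> ^ n * \<bar>x - z\<bar> + (\<beta> ^ n / 2) * \<bar>x - z\<bar>"
      using n(2) by (intro add_left_mono mult_right_mono) auto
    also have "\<dots> < \<phi> n"
    proof -
      have "\<beta> ^ n * \<bar>x - z\<bar> < \<beta> ^ n * \<rho>"
        using x pow_pos[of n] by (intro mult_strict_left_mono) auto
      then show ?thesis using \<rho>(2) \<phi>_pos[OF n(1)] by simp
    qed
    finally show "x \<in> hits n \<inter> {a..<e}" using x e by (simp add: hits_def)
  qed
  then have "measure lebesgue {max a (z - \<rho>)<..<min e (z + \<rho>)}
      \<le> measure lebesgue (hits n \<inter> {a..<e})"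
    by (rule measure_mono_fmeasurable) (simp_all add: hits_Int_lmeasurable)
  moreover have "\<rho> \<le> measure lebesgue {max a (z - \<rho>)<..<min e (z + \<rho>)}"
  proof -
    have "\<rho> \<le> min e (z + \<rho>) - max a (z - \<rho>)" using z \<rho>(1) short by linarith
    moreover have "p \<le> measure lebesgue {l<..<h}" if "p \<le> h - l" "0 < p" for p l h :: real
      using that by simp
    ultimately show ?thesis using \<rho>(1) by blast
  qed
  ultimately show ?thesis unfolding e_def \<rho>_def by linarith
qed

lemma eventually_large: "\<forall>\<^sub>F n in sequentially. 1 \<le> n \<and> 2 * C \<le> \<beta> ^ n"
proof (rule eventually_conj)
  show "\<forall>\<^sub>F n in sequentially. 1 \<le> n" by (rule eventually_ge_at_top)
  show "\<forall>\<^sub>F n in sequentially. 2 * C \<le> \<beta> ^ n"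
    using eventually_linear_le[of "2 * C" 1] C_nonneg by (auto elim: eventually_mono)
qed

lemma measure_hits_interval_ge:
  obtains \<gamma> where "0 < \<gamma>"
    "\<And>u v. 0 \<le> u \<Longrightarrow> u < v \<Longrightarrow> v \<le> 1 \<Longrightarrow> \<forall>\<^sub>F n in sequentially.
       \<gamma> * (v - u) * \<phi> n \<le> measure lebesgue (hits n \<inter> {u..v})"
proof -
  obtain \<kappa> where \<kappa>: "0 < \<kappa>"
    "\<And>u v. 0 \<le> u \<Longrightarrow> u < v \<Longrightarrow> v \<le> 1 \<Longrightarrow> \<forall>\<^sub>F n in sequentially.
       \<exists>G. finite G \<and> G \<subseteq> full n \<and> (\<forall>a\<in>G. u \<le> a \<and> a + 1 / \<beta> ^ n \<le> v) \<and>
           \<kappa> * \<beta> ^ n * (v - u) \<le> real (card G)"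
    using full_card_ge by blast
  show thesis
  proof (rule that[of "\<kappa> / 2"])
    fix u v :: real assume uv: "0 \<le> u" "u < v" "v \<le> 1"
    from \<kappa>(2)[OF uv] eventually_large show "\<forall>\<^sub>F n in sequentially.
       \<kappa> / 2 * (v - u) * \<phi> n \<le> measure lebesgue (hits n \<inter> {u..v})"
    proof eventually_elim
      case (elim n)
      from elim(1) obtain G where G: "finite G" "G \<subseteq> full n" "\<And>a. a \<in> G \<Longrightarrow> u \<le> a \<and> a + 1 / \<beta> ^ n \<le> v"
        "\<kappa> * \<beta> ^ n * (v - u) \<le> real (card G)" by blast
      define H where "H a = hits n \<inter> {a..<a + 1 / \<beta> ^ n}" for a
      note n = elim(2)
      have q: "0 \<le> \<phi> n / (2 * \<beta> ^ n)" using \<phi>_pos[of n] n pow_pos[of n] by simp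
      have disj: "disjoint_family_on H G"
        unfolding disjoint_family_on_def
      proof (intro ballI impI)
        fix a b assume ab: "a \<in> G" "b \<in> G" "a \<noteq> b"
        then have "a + 1 / \<beta> ^ n \<le> b \<or> b + 1 / \<beta> ^ n \<le> a"
          using full_gap[of a n b] full_gap[of b n a] full_subset_zeros G(2)
          by (meson linorder_neq_iff subsetD)
        then show "H a \<inter> H b = {}" by (auto simp: H_def)
      qed
      have "\<kappa> / 2 * (v - u) * \<phi> n = (\<kappa> * \<beta> ^ n * (v - u)) * (\<phi> n / (2 * \<beta> ^ n))"
        by (simp add: field_simps)
      also have "\<dots> \<le> real (card G) * (\<phi> n / (2 * \<beta> ^ n))"
        using G(4) q by (rule mult_right_mono)
      also have "\<dots> \<le> (\<Sum>a\<in>G. measure lebesgue (H a))"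
      proof -
        have "(\<Sum>a\<in>G. \<phi> n / (2 * \<beta> ^ n)) \<le> (\<Sum>a\<in>G. measure lebesgue (H a))"
          unfolding H_def using G(2) n by (intro sum_mono measure_hits_full_ge) auto
        then show ?thesis by simp
      qed
      also have "\<dots> = measure lebesgue (\<Union>a\<in>G. H a)"
      proof (rule measure_finite_Union[symmetric, OF G(1) _ disj])
        show "H ` G \<subseteq> sets lebesgue" using hits_sets by (auto simp: H_def)
        show "emeasure lebesgue (H a) \<noteq> \<infinity>" for a
          using fmeasurableD2[OF hits_Int_lmeasurable[of "{a..<a + 1 / \<beta> ^ n}" n]]
          by (simp add: H_def)
      qed
      also have "\<dots> \<le> measure lebesgue (hits n \<inter> {u..v})"
      proof (rule measure_mono_fmeasurable)
        show "(\<Union>a\<in>G. H a) \<subseteq> hits n \<inter> {u..v}" using G(3) by (force simp: H_def)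
        show "(\<Union>a\<in>G. H a) \<in> sets lebesgue"
          using G(1) hits_sets by (intro sets.finite_UN) (auto simp: H_def)
      qed (simp add: hits_Int_lmeasurable)
      finally show ?case .
    qed
  qed (use \<kappa> in simp)
qed

lemma limsup_hits_null:
  assumes "summable \<phi>"
  shows "limsup hits \<in> null_sets lebesgue"
proof (rule borel_cantelli_limsup1)
  show "emeasure lebesgue (hits n) < \<infinity>" for n
    using fmeasurableD2[OF hits_Int_lmeasurable[of UNIV n]] by (simp add: less_top)
  show "summable (\<lambda>n. measure lebesgue (hits n))"
  proof (rule summable_comparison_test_ev)
    show "summable (\<lambda>n. 4 * (K\<^sup>2 + K) * \<phi> n)" using assms by (rule summable_mult)
    show "\<forall>\<^sub>F n in sequentially. norm (measure lebesgue (hits n)) \<le> 4 * (K\<^sup>2 + K) * \<phi> n"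
      using eventually_large
    proof eventually_elim
      case (elim n)
      then show ?case using measure_hits_le[of n] by simp
    qed
  qed
qed (rule hits_sets)

text \<open>Second moment of the number of hits in an interval. Summed over \<open>m\<close>, the error terms
  \<open>real (Suc (n - m)) / \<beta> ^ (n - m)\<close> of \<open>measure_hits_pair_le\<close> contribute at most \<open>K\<^sup>2\<close>, hence a total
  linear in \<open>sum \<phi> I\<close>, which the square dominates as soon as the sum is at least \<open>1\<close>.\<close>

lemma measure_hits_pairs_sum_le:
  assumes uv: "0 \<le> u" "u \<le> v" and I: "finite I"
    and big: "\<And>n. n \<in> I \<Longrightarrow> 1 \<le> n \<and> 2 * C \<le> \<beta> ^ n \<and> 1 + real n \<le> K * (v - u) * \<beta> ^ n"
    and S: "1 \<le> sum \<phi> I"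
  shows "(\<Sum>m\<in>I. \<Sum>n\<in>I. measure lebesgue ((hits m \<inter> {u..v}) \<inter> (hits n \<inter> {u..v})))
    \<le> 16 * K\<^sup>2 * (4 + K) * (v - u) * (sum \<phi> I)\<^sup>2"
proof -
  define S where "S = sum \<phi> I"
  define q where "q j = real (Suc j) / \<beta> ^ j" for j
  define r where "r m n = (if m \<le> n then q (n - m) else 0)" for m n :: nat
  \<comment> \<open>Truncating the error term at \<open>n < m\<close> turns the bound for ordered pairs into the symmetric bound
    \<open>w m n + w n m\<close> for all pairs.\<close>
  define w where "w m n = 8 * K * (v - u) * \<phi> n * (4 * K * \<phi> m + r m n)" for m n
  have q_nonneg: "0 \<le> q j" for j using pow_pos[of j] by (simp add: q_def)
  have \<phi>_nonneg: "0 \<le> \<phi> n" if "n \<in> I" for n using \<phi>_pos[of n] big[OF that] by simp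
  have w_nonneg: "0 \<le> w m n" if "m \<in> I" "n \<in> I" for m n
    using \<phi>_nonneg[OF that(1)] \<phi>_nonneg[OF that(2)] q_nonneg[of "n - m"] K_gt_1 uv by (simp add: w_def r_def)
  have pair: "measure lebesgue ((hits m \<inter> {u..v}) \<inter> (hits n \<inter> {u..v})) \<le> w m n"
    if "m \<in> I" "n \<in> I" "m \<le> n" for m n
  proof -
    have "(hits m \<inter> {u..v}) \<inter> (hits n \<inter> {u..v}) = hits m \<inter> hits n \<inter> {u..v}" by blast
    then show ?thesis
      using measure_hits_pair_le[of m n u v] big[OF that(1)] that(3) uv(2)
      by (simp add: w_def r_def q_def)
  qed
  have "(\<Sum>m\<in>I. \<Sum>n\<in>I. measure lebesgue ((hits m \<inter> {u..v}) \<inter> (hits n \<inter> {u..v})))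
      \<le> (\<Sum>m\<in>I. \<Sum>n\<in>I. w m n + w n m)"
  proof (intro sum_mono)
    fix m n assume mn: "m \<in> I" "n \<in> I"
    show "measure lebesgue ((hits m \<inter> {u..v}) \<inter> (hits n \<inter> {u..v})) \<le> w m n + w n m"
    proof (cases "m \<le> n")
      case True
      then show ?thesis using pair[OF mn] w_nonneg[OF mn(2,1)] by linarith
    next
      case False
      then show ?thesis using pair[OF mn(2,1)] w_nonneg[OF mn] by (simp add: Int_commute)
    qed
  qed
  also have "\<dots> = 2 * (\<Sum>n\<in>I. \<Sum>m\<in>I. w m n)"
    using sum.swap[of w I I] by (simp add: sum.distrib)
  also have "(\<Sum>n\<in>I. \<Sum>m\<in>I. w m n) \<le> (\<Sum>n\<in>I. 8 * K * (v - u) * \<phi> n * (4 * K * S + K\<^sup>2))"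
  proof (rule sum_mono)
    fix n assume n: "n \<in> I"
    have "(\<Sum>m\<in>I. r m n) = (\<Sum>m\<in>{m \<in> I. m \<le> n}. q (n - m))"
      unfolding r_def using I by (rule sum.inter_filter[symmetric])
    also have "\<dots> = sum q ((\<lambda>m. n - m) ` {m \<in> I. m \<le> n})"
      by (subst sum.reindex) (auto simp: inj_on_def)
    also have "\<dots> \<le> suminf q"
      using I q_nonneg pow_inverse_sum(1) by (intro sum_le_suminf) (auto simp: q_def[abs_def])
    finally have "(\<Sum>m\<in>I. r m n) \<le> K\<^sup>2" using pow_inverse_sum(2) by (simp add: q_def[abs_def])
    then have "8 * K * (v - u) * \<phi> n * (4 * K * S + (\<Sum>m\<in>I. r m n))
        \<le> 8 * K * (v - u) * \<phi> n * (4 * K * S + K\<^sup>2)"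
      using \<phi>_nonneg[OF n] K_gt_1 uv by (intro mult_left_mono) auto
    then show "(\<Sum>m\<in>I. w m n) \<le> 8 * K * (v - u) * \<phi> n * (4 * K * S + K\<^sup>2)"
      by (simp add: w_def S_def sum_distrib_left[symmetric] sum.distrib)
  qed
  also have "(\<Sum>n\<in>I. 8 * K * (v - u) * \<phi> n * (4 * K * S + K\<^sup>2)) = 8 * K * (v - u) * S * (4 * K * S + K\<^sup>2)"
    by (simp add: S_def sum_distrib_left sum_distrib_right)
  also have "\<dots> \<le> 8 * K * (v - u) * S * (4 * K * S + K\<^sup>2 * S)"
    using S K_gt_1 uv by (intro mult_left_mono add_left_mono) (auto simp: S_def)
  also have "2 * \<dots> = 16 * K\<^sup>2 * (4 + K) * (v - u) * S\<^sup>2"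
    by (simp add: power2_eq_square algebra_simps)
  finally show ?thesis by (simp add: S_def)
qed

text \<open>The constant \<open>c\<close> must not depend on the interval. How far out in the tail one has to go before
  the estimates hold does depend on it, but divergence leaves enough mass beyond any index.\<close>

lemma measure_tail_hits_ge:
  assumes div: "\<not> summable \<phi>"
  obtains c where "0 < c"
    "\<And>u v M. 0 \<le> u \<Longrightarrow> u < v \<Longrightarrow> v \<le> 1 \<Longrightarrow>
       c * (v - u) \<le> measure lebesgue ({u..v} \<inter> (\<Union>n\<in>{M..}. hits n))"
proof -
  obtain \<gamma> where \<gamma>: "0 < \<gamma>"
    "\<And>u v. 0 \<le> u \<Longrightarrow> u < v \<Longrightarrow> v \<le> 1 \<Longrightarrow> \<forall>\<^sub>F n in sequentially.
       \<gamma> * (v - u) * \<phi> n \<le> measure lebesgue (hits n \<inter> {u..v})"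
    using measure_hits_interval_ge by blast
  define c1 where "c1 = 16 * K\<^sup>2 * (4 + K)"
  have c1: "0 < c1" using K_gt_1 by (simp add: c1_def)
  show thesis
  proof (rule that[of "\<gamma>\<^sup>2 / c1"])
    show "0 < \<gamma>\<^sup>2 / c1" using \<gamma>(1) c1 by simp
    fix u v :: real and M :: nat assume uv: "0 \<le> u" "u < v" "v \<le> 1"
    have "\<forall>\<^sub>F n in sequentially. 1 + real n \<le> (K * (v - u)) * \<beta> ^ n"
      using K_gt_1 uv by (intro eventually_linear_le) auto
    with eventually_large \<gamma>(2)[OF uv]
    have "\<forall>\<^sub>F n in sequentially. 1 \<le> n \<and> 2 * C \<le> \<beta> ^ n \<and> 1 + real n \<le> K * (v - u) * \<beta> ^ n
        \<and> \<gamma> * (v - u) * \<phi> n \<le> measure lebesgue (hits n \<inter> {u..v})"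
      by eventually_elim simp
    then obtain N0 where N0: "\<And>n. N0 \<le> n \<Longrightarrow> 1 \<le> n \<and> 2 * C \<le> \<beta> ^ n
        \<and> 1 + real n \<le> K * (v - u) * \<beta> ^ n
        \<and> \<gamma> * (v - u) * \<phi> n \<le> measure lebesgue (hits n \<inter> {u..v})"
      unfolding eventually_sequentially by blast
    define N where "N = max M N0"
    have \<phi>_nonneg: "0 \<le> \<phi> n" if "N \<le> n" for n
      using \<phi>_pos[of n] N0[of n] that by (simp add: N_def)
    \<comment> \<open>Enough terms for the quadratic part of the second moment to dominate.\<close>
    obtain k where k: "1 < (\<Sum>i<k. \<phi> (i + N))"
    proof (rule ccontr)
      assume "\<not> thesis"
      with that have "(\<Sum>i<k. \<phi> (i + N)) \<le> 1" for k by (meson not_le)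
      then have "summable (\<lambda>i. \<phi> (i + N))"
        using \<phi>_nonneg by (intro summableI_nonneg_bounded[of _ 1]) auto
      then show False using div by (simp only: summable_iff_shift)
    qed
    define I where "I = (\<lambda>i. i + N) ` {..<k}"
    have I: "finite I" "\<And>n. n \<in> I \<Longrightarrow> N0 \<le> n" "I \<subseteq> {M..}"
      by (auto simp: I_def N_def)
    define S where "S = sum \<phi> I"
    have S: "1 \<le> S" using k unfolding S_def I_def by (subst sum.reindex) (auto simp: inj_on_def)
    define E where "E n = hits n \<inter> {u..v}" for n
    define \<mu> where "\<mu> = measure lebesgue (\<Union>n\<in>I. E n)"
    have E: "E n \<in> lmeasurable" for n by (simp add: E_def hits_Int_lmeasurable)
    have "\<gamma> * (v - u) * S \<le> (\<Sum>n\<in>I. measure lebesgue (E n))"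
      unfolding S_def E_def sum_distrib_left using N0 I(2) by (intro sum_mono) blast
    then have "(\<gamma> * (v - u) * S)\<^sup>2 \<le> (\<Sum>n\<in>I. measure lebesgue (E n))\<^sup>2"
      using \<gamma>(1) uv S by (intro power_mono) auto
    also have "\<dots> \<le> \<mu> * (\<Sum>m\<in>I. \<Sum>n\<in>I. measure lebesgue (E m \<inter> E n))"
      unfolding \<mu>_def using I(1) E by (rule Chung_Erdos)
    also have "\<dots> \<le> \<mu> * (c1 * (v - u) * S\<^sup>2)"
      unfolding c1_def S_def E_def
    proof (intro mult_left_mono measure_hits_pairs_sum_le)
      show "1 \<le> n \<and> 2 * C \<le> \<beta> ^ n \<and> 1 + real n \<le> K * (v - u) * \<beta> ^ n" if "n \<in> I" for n
        using N0[OF I(2)[OF that]] by blast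
    qed (use uv I(1) S in \<open>auto simp: \<mu>_def S_def\<close>)
    finally have "(\<gamma>\<^sup>2 * (v - u)) * ((v - u) * S\<^sup>2) \<le> (\<mu> * c1) * ((v - u) * S\<^sup>2)"
      by (simp add: power2_eq_square mult_ac)
    moreover have "0 < (v - u) * S\<^sup>2" using uv S by simp
    ultimately have "\<gamma>\<^sup>2 * (v - u) \<le> \<mu> * c1" by (rule mult_right_le_imp_le)
    then have "\<gamma>\<^sup>2 / c1 * (v - u) \<le> \<mu>" using c1 by (simp add: field_simps)
    also have "\<mu> \<le> measure lebesgue ({u..v} \<inter> (\<Union>n\<in>{M..}. hits n))"
      unfolding \<mu>_def
    proof (rule measure_mono_fmeasurable)
      show "(\<Union>n\<in>I. E n) \<subseteq> {u..v} \<inter> (\<Union>n\<in>{M..}. hits n)" using I(3) by (auto simp: E_def)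
      show "(\<Union>n\<in>I. E n) \<in> sets lebesgue" using I(1) E by (intro sets.finite_UN) auto
      show "{u..v} \<inter> (\<Union>n\<in>{M..}. hits n) \<in> lmeasurable"
        using hits_sets by (intro fmeasurable_Int_fmeasurable sets.countable_UN') auto
    qed
    finally show "\<gamma>\<^sup>2 / c1 * (v - u) \<le> measure lebesgue ({u..v} \<inter> (\<Union>n\<in>{M..}. hits n))" .
  qed
qed

lemma negligible_avoiding:
  assumes "\<not> summable \<phi>"
  shows "negligible ({0..1} - (\<Union>n\<in>{M..}. hits n))"
proof -
  obtain c where c: "0 < c"
    "\<And>u v M. 0 \<le> u \<Longrightarrow> u < v \<Longrightarrow> v \<le> 1 \<Longrightarrow>
       c * (v - u) \<le> measure lebesgue ({u..v} \<inter> (\<Union>n\<in>{M..}. hits n))"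
    using measure_tail_hits_ge[OF assms] by blast
  define U where "U = (\<Union>n\<in>{M..}. hits n)"
  have U: "U \<in> sets lebesgue" unfolding U_def using hits_sets by (intro sets.countable_UN') auto
  have "negligible ({0..1} - U)"
  proof (rule negligible_if_density_bounded[OF _ _ c(1)])
    fix u v :: real assume uv: "0 \<le> u" "u < v" "v \<le> 1"
    have "{u..v} \<inter> ({0..1} - U) = {u..v} - ({u..v} \<inter> U)" using uv by auto
    moreover have "measure lebesgue ({u..v} - ({u..v} \<inter> U))
        = measure lebesgue {u..v} - measure lebesgue ({u..v} \<inter> U)"
      using U by (intro measurable_measure_Diff) auto
    ultimately show "measure lebesgue ({u..v} \<inter> ({0..1} - U)) \<le> (1 - c) * (v - u)"
      using c(2)[OF uv, of M] uv by (simp add: U_def algebra_simps)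
  qed (use U in auto)
  then show ?thesis by (simp add: U_def)
qed

lemma recurrence_set_eq_limsup:
  "recurrence_set \<beta> L \<phi> \<inter> {0..<1} = limsup hits"
proof (intro set_eqI)
  fix x
  have "x \<in> limsup hits \<longleftrightarrow> infinite {n. x \<in> hits n}"
    by (simp add: limsup_INF_SUP infinite_nat_iff_unbounded_le Bex_def)
  \<comment> \<open>The index \<open>0\<close>, admitted by the limit superior, does not affect infinitude.\<close>
  also have "{n. x \<in> hits n} = {n. 1 \<le> n \<and> x \<in> hits n} \<union> {n. n = 0 \<and> x \<in> hits n}"
    by (auto simp: not_le)
  also have "infinite \<dots> \<longleftrightarrow> infinite {n. 1 \<le> n \<and> x \<in> hits n}" by simp
  also have "\<dots> \<longleftrightarrow> x \<in> recurrence_set \<beta> L \<phi> \<inter> {0..<1}"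
    by (cases "x \<in> {0..<1}") (auto simp: recurrence_set_def hits_def)
  finally show "x \<in> recurrence_set \<beta> L \<phi> \<inter> {0..<1} \<longleftrightarrow> x \<in> limsup hits" by blast
qed

lemma limsup_hits_sets: "limsup hits \<in> sets lebesgue"
  unfolding limsup_INF_SUP using hits_sets by (intro sets.countable_INT sets.countable_UN') auto

text \<open>Cylinders live on \<open>[0,1)\<close>; the point \<open>1\<close> is put aside as a null set.\<close>

lemma recurrence_set_split:
  obtains Z where "Z \<in> null_sets lebesgue" "recurrence_set \<beta> L \<phi> = limsup hits \<union> Z"
proof (rule that)
  have "recurrence_set \<beta> L \<phi> \<subseteq> {0..<1} \<union> {1}"
    by (auto simp: recurrence_set_def)
  then show "recurrence_set \<beta> L \<phi> = limsup hits \<union> (recurrence_set \<beta> L \<phi> \<inter> {1})"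
    using recurrence_set_eq_limsup by blast
  show "recurrence_set \<beta> L \<phi> \<inter> {1} \<in> null_sets lebesgue"
    by (rule null_sets_completion_subset[of _ "{1}"]) (auto)
qed

lemma emeasure_limsup_hits:
  assumes "\<not> summable \<phi>"
  shows "emeasure lebesgue (limsup hits) = 1"
proof -
  have null: "{0..1} - limsup hits \<in> null_sets lebesgue"
  proof -
    have eq: "{0..1} - limsup hits = (\<Union>M. {0..1} - (\<Union>n\<in>{M..}. hits n))"
      by (auto simp: limsup_INF_SUP)
    show ?thesis
      unfolding eq using negligible_avoiding[OF assms]
      by (intro null_sets_UN) (simp only: negligible_iff_null_sets)
  qed
  have "limsup hits \<subseteq> {0..<1}" using recurrence_set_eq_limsup by blast
  then have "limsup hits \<union> ({0..1} - limsup hits) = {0..1}" by auto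
  then have "emeasure lebesgue (limsup hits) = emeasure lebesgue {0..1::real}"
    using emeasure_Un_null_set[OF limsup_hits_sets null] by simp
  then show ?thesis by simp
qed

end

section \<open>The zero-one law\<close>

theorem theorem1p6:
  fixes L :: "real \<Rightarrow> real" and \<phi> :: "nat \<Rightarrow> real" and \<beta> :: real
  assumes L_maps: "L \<in> {0..1} \<rightarrow> {0..1}"
    and L_lipschitz: "\<exists>C. C-lipschitz_on {0..1} L"
    and \<phi>_range: "\<And>n. 1 \<le> n \<Longrightarrow> 0 < \<phi> n \<and> \<phi> n \<le> 1"
    and \<beta>: "1 < \<beta>"
  shows "recurrence_set \<beta> L \<phi> \<in> sets lebesgue
    \<and> ((\<Sum>n. ennreal (\<phi> (Suc n))) < \<infinity> \<longrightarrow> emeasure lebesgue (recurrence_set \<beta> L \<phi>) = 0)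
    \<and> ((\<Sum>n. ennreal (\<phi> (Suc n))) = \<infinity> \<longrightarrow> emeasure lebesgue (recurrence_set \<beta> L \<phi>) = 1)"
proof -
  obtain C where C: "C-lipschitz_on {0..1} L" using L_lipschitz by blast
  interpret beta_recurrence \<beta> L C \<phi>
    by unfold_locales (use L_maps C \<phi>_range \<beta> in auto)
  obtain Z where Z: "Z \<in> null_sets lebesgue" "recurrence_set \<beta> L \<phi> = limsup hits \<union> Z"
    by (rule recurrence_set_split)
  have sets: "recurrence_set \<beta> L \<phi> \<in> sets lebesgue"
    using Z limsup_hits_sets by auto
  have em: "emeasure lebesgue (recurrence_set \<beta> L \<phi>) = emeasure lebesgue (limsup hits)"
    using emeasure_Un_null_set[OF limsup_hits_sets Z(1)] by (simp add: Z(2))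
  have sum: "summable \<phi> \<longleftrightarrow> (\<Sum>n. ennreal (\<phi> (Suc n))) \<noteq> \<infinity>"
  proof -
    have nn: "0 \<le> \<phi> (Suc n)" for n using \<phi>_range[of "Suc n"] by simp
    have "summable (\<lambda>n. \<phi> (Suc n)) \<longleftrightarrow> (\<Sum>n. ennreal (\<phi> (Suc n))) \<noteq> \<infinity>"
    proof
      assume "summable (\<lambda>n. \<phi> (Suc n))"
      from suminf_ennreal2[OF nn this]
      show "(\<Sum>n. ennreal (\<phi> (Suc n))) \<noteq> \<infinity>" by simp
    next
      assume "(\<Sum>n. ennreal (\<phi> (Suc n))) \<noteq> \<infinity>"
      then show "summable (\<lambda>n. \<phi> (Suc n))" using nn by (intro summable_suminf_not_top) auto
    qed
    then show ?thesis by (simp add: summable_Suc_iff)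
  qed
  show ?thesis
    using sets em sum limsup_hits_null emeasure_limsup_hits by (auto simp: less_top)
qed

end
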